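(* Let $\mathcal{A} \subset \mathbb{R}$ be a set with $2 \le \mathrm{card}\, \mathcal{A} < \infty$. Then there is a minimal subshift $\Omega \subset \mathcal{A}^{\mathbb{Z}}$, which is not periodic, such that the associated set $\Sigma \subset \mathbb{R}$ (the common spectrum of the Schrödinger operators $H_\omega$, $\omega \in \Omega$) has strictly positive Lebesgue measure.
   Context: For a finite set $\mathcal{A} \subset \mathbb{R}$, equip $\mathcal{A}^{\mathbb{Z}}$ with the product topology and let $T$ be the shift, $(T\omega)_n = \omega_{n+1}$. A subshift is a nonempty $T$-invariant compact subset $\Omega$ of $\mathcal{A}^{\mathbb{Z}}$. It is minimal if the $T$-orbit of every $\omega \in \Omega$ is dense in $\Omega$. If $\Omega$ is minimal, then either all of its elements are periodic sequences or none of them is; in the latter case $\Omega$ is called not periodic. For $\omega \in \Omega$, $H_\omega$ is the bounded self-adjoint operator on $\ell^2(\mathbb{Z})$ given by $[H_\omega \psi](n) = \psi(n+1) + \psi(n-1) + \omega_n \psi(n)$. If $\Omega$ is minimal, there is a compact set $\Sigma \subset \mathbb{R}$ with $\sigma(H_\omega) = \Sigma$ for every $\omega \in \Omega$; this is the set $\Sigma$ associated with $\Omega$. *)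

theory Defs
  imports "HOL-Analysis.Analysis"
begin

section \<open>Subshifts\<close>

text \<open>Two-sided sequences have type \<open>int \<Rightarrow> real\<close>, whose library topology is the product topology.
  For finite \<open>A\<close>, the subspace topology it induces on \<open>full_shift A\<close> is the product of the discrete
  topologies on \<open>A\<close>.\<close>

definition full_shift :: "real set \<Rightarrow> (int \<Rightarrow> real) set" where
  "full_shift A = {\<omega>. \<forall>n. \<omega> n \<in> A}"

definition shift :: "(int \<Rightarrow> real) \<Rightarrow> (int \<Rightarrow> real)" where
  "shift \<omega> = (\<lambda>n. \<omega> (n + 1))"

definition subshift :: "real set \<Rightarrow> (int \<Rightarrow> real) set \<Rightarrow> bool" where
  "subshift A \<Omega> \<longleftrightarrow> \<Omega> \<noteq> {} \<and> \<Omega> \<subseteq> full_shift A \<and> compact \<Omega> \<and> shift ` \<Omega> = \<Omega>"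

text \<open>The shift is invertible, and its \<open>k\<close>-th iterate, for any integer \<open>k\<close>, is translation by \<open>k\<close>;
  orbits are two-sided.\<close>

definition shift_orbit :: "(int \<Rightarrow> real) \<Rightarrow> (int \<Rightarrow> real) set" where
  "shift_orbit \<omega> = range (\<lambda>k::int. \<lambda>n. \<omega> (n + k))"

definition minimal_subshift :: "real set \<Rightarrow> (int \<Rightarrow> real) set \<Rightarrow> bool" where
  "minimal_subshift A \<Omega> \<longleftrightarrow> subshift A \<Omega> \<and> (\<forall>\<omega>\<in>\<Omega>. \<Omega> \<subseteq> closure (shift_orbit \<omega>))"

definition periodic_seq :: "(int \<Rightarrow> real) \<Rightarrow> bool" where
  "periodic_seq \<omega> \<longleftrightarrow> (\<exists>p>0. \<forall>n. \<omega> (n + p) = \<omega> n)"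

definition not_periodic :: "(int \<Rightarrow> real) set \<Rightarrow> bool" where
  "not_periodic \<Omega> \<longleftrightarrow> (\<forall>\<omega>\<in>\<Omega>. \<not> periodic_seq \<omega>)"


section \<open>Operators on the complex Hilbert space of square-summable two-sided sequences\<close>

definition l2 :: "(int \<Rightarrow> complex) set" where
  "l2 = {\<psi>. (\<lambda>n. (cmod (\<psi> n))\<^sup>2) summable_on UNIV}"

definition l2_norm :: "(int \<Rightarrow> complex) \<Rightarrow> real" where
  "l2_norm \<psi> = sqrt (\<Sum>\<^sub>\<infinity>n. (cmod (\<psi> n))\<^sup>2)"

text \<open>Operators are functions on all sequences; only their values on \<open>l2\<close> matter.\<close>

definition bounded_operator :: "((int \<Rightarrow> complex) \<Rightarrow> (int \<Rightarrow> complex)) \<Rightarrow> bool" where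
  "bounded_operator S \<longleftrightarrow>
     (\<forall>\<psi>\<in>l2. S \<psi> \<in> l2) \<and>
     (\<forall>\<phi>\<in>l2. \<forall>\<psi>\<in>l2. S (\<lambda>n. \<phi> n + \<psi> n) = (\<lambda>n. S \<phi> n + S \<psi> n)) \<and>
     (\<forall>c. \<forall>\<psi>\<in>l2. S (\<lambda>n. c * \<psi> n) = (\<lambda>n. c * S \<psi> n)) \<and>
     (\<exists>C. \<forall>\<psi>\<in>l2. l2_norm (S \<psi>) \<le> C * l2_norm \<psi>)"

text \<open>\<open>z\<close> lies in the spectrum of \<open>S\<close> iff \<open>S - z\<close> has no bounded two-sided inverse on \<open>l2\<close>.\<close>

definition spectrum :: "((int \<Rightarrow> complex) \<Rightarrow> (int \<Rightarrow> complex)) \<Rightarrow> complex set" where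
  "spectrum S = {z. \<not> (\<exists>R. bounded_operator R \<and>
     (\<forall>\<psi>\<in>l2. R (\<lambda>n. S \<psi> n - z * \<psi> n) = \<psi> \<and> (\<lambda>n. S (R \<psi>) n - z * R \<psi> n) = \<psi>))}"

definition schrodinger :: "(int \<Rightarrow> real) \<Rightarrow> (int \<Rightarrow> complex) \<Rightarrow> (int \<Rightarrow> complex)" where
  "schrodinger \<omega> \<psi> = (\<lambda>n. \<psi> (n + 1) + \<psi> (n - 1) + complex_of_real (\<omega> n) * \<psi> n)"

text \<open>For nonempty \<open>\<Omega>\<close> there is at most one such \<open>\<Sigma>\<close>; for minimal \<open>\<Omega>\<close> there is exactly one.\<close>

definition associated_spectrum :: "(int \<Rightarrow> real) set \<Rightarrow> real set \<Rightarrow> bool" where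
  "associated_spectrum \<Omega> \<Sigma> \<longleftrightarrow>
     compact \<Sigma> \<and> (\<forall>\<omega>\<in>\<Omega>. spectrum (schrodinger \<omega>) = complex_of_real ` \<Sigma>)"

end

theory Submission
  imports Defs "HOL-Library.Sublist" "HOL-Computational_Algebra.Polynomial"
begin

text \<open>The idea is to keep the bands of periodic approximants alive in a hierarchical, aperiodic and
  minimal subshift over two letters \<open>a \<noteq> b\<close>.

  Let \<open>w\<close> and \<open>u\<close> be finite words and let the transfer matrix of \<open>w\<close> at energy \<open>E\<close> be elliptic, a
  rotation by an angle \<open>\<theta>\<close> up to conjugation; this holds on the spectrum of the \<open>w\<close>-periodic sequence
  except at finitely many energies and defines the band of \<open>w\<close>. Inserting the defect \<open>u\<close> after every
  \<open>m\<close> copies of \<open>w\<close> gives the trace \<open>r cos (m \<theta> - \<phi>)\<close>, which for a single \<open>m\<close> may exceed \<open>2\<close> in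
  modulus on a sizeable set of energies. But if
  \<open>\<theta>\<close> is an irrational multiple of \<open>\<pi>\<close>, which excludes only countably many \<open>E\<close>, then some large \<open>m\<close>
  makes this trace small. So the sequences with periods \<open>w\<^sup>m u\<close>, with \<open>m\<close> in a large enough finite range,
  together have in their spectra all of the band of \<open>w\<close> up to a set of arbitrarily small measure
  (\<open>countable_band_minus_defects\<close>, \<open>finitely_many_exponents_suffice\<close>).

  Starting from the blocks \<open>a\<close> and \<open>b\<close>, the blocks of level \<open>k + 1\<close> are the words \<open>w\<^sup>m u\<close> where \<open>w\<close> is
  a block of level \<open>k\<close>, \<open>u\<close> is the concatenation of all these blocks, and \<open>m\<close> runs through a range that
  starts at \<open>k + 2\<close> and is so long that at most the measure \<open>2\<^sup>-\<^sup>k\<close> is lost from the bands. The band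
  \<open>(a - 2, a + 2)\<close> of the constant sequence \<open>a\<close> has length \<open>4\<close>, so a set of measure at least \<open>2\<close> lies in
  the bands of all levels (\<open>hierarchy_with_persistent_bands\<close>). Let \<open>\<Omega>\<close> consist of the sequences all of
  whose finite windows are factors of the words \<open>u\<close> of the various levels. As \<open>u\<close> is part of every block of
  the next level, \<open>\<Omega>\<close> is minimal (\<open>minimal_language_shift\<close>), and having two consecutive exponents \<open>m\<close> at every
  level prevents periodicity (\<open>not_periodic_language_shift\<close>).

  If \<open>E\<close> lies in the bands of all levels, then for each \<open>k\<close> it lies in the band of some block \<open>w\<close> of level
  \<open>k\<close>, and \<open>w\<close> is repeated \<open>k + 2\<close> times somewhere in every element of \<open>\<Omega>\<close>. Cutting off a Bloch solution
  for \<open>w\<close> to these repetitions gives approximate eigenvectors with an error of order \<open>1 / sqrt k\<close>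
  (\<open>band_bounded_below\<close>), so \<open>E\<close> belongs to the spectrum.

  On the operator side, \<open>z\<close> is outside the spectrum iff \<open>H - z\<close> is bounded below on \<open>l2\<close>
  (\<open>spectrum_iff_not_bounded_below\<close>). Being bounded below is tested on finitely supported sequences, hence
  on finite windows of the potential (\<open>bounded_below_transfer\<close>), and so all elements of a minimal subshift
  have the same spectrum.\<close>

section \<open>Square-summable sequences\<close>

text \<open>Bounds on finite partial sums survive pointwise limits, so this criterion replaces the completeness
  of \<open>l2\<close> in the construction of resolvents below.\<close>

lemma l2_by_finite_sums:
  assumes "\<And>F. finite F \<Longrightarrow> L2_set (\<lambda>n. cmod (\<psi> n)) F \<le> M"
  shows "\<psi> \<in> l2" and "l2_norm \<psi> \<le> M"
proof -
  have M: "0 \<le> M" using assms[of "{}"] by simp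
  have F: "(\<Sum>n\<in>F. (cmod (\<psi> n))\<^sup>2) \<le> M\<^sup>2" if "finite F" for F
    using assms[OF that] M unfolding L2_set_def
    by (metis real_sqrt_le_iff real_sqrt_abs abs_of_nonneg)
  have s: "(\<lambda>n. (cmod (\<psi> n))\<^sup>2) summable_on UNIV"
    by (rule nonneg_bdd_above_summable_on) (auto intro!: bdd_aboveI2[of _ _ "M\<^sup>2"] F)
  then show "\<psi> \<in> l2" by (simp add: l2_def)
  have "(\<Sum>\<^sub>\<infinity>n. (cmod (\<psi> n))\<^sup>2) \<le> M\<^sup>2"
    by (rule infsum_le_finite_sums[OF s]) (use F in auto)
  then show "l2_norm \<psi> \<le> M" unfolding l2_norm_def using M by (simp add: real_le_lsqrt)
qed

lemma L2_set_le_l2_norm: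
  assumes "\<psi> \<in> l2" "finite F"
  shows "L2_set (\<lambda>n. cmod (\<psi> n)) F \<le> l2_norm \<psi>"
  unfolding L2_set_def l2_norm_def
  by (rule real_sqrt_le_mono, rule finite_sum_le_infsum) (use assms in \<open>auto simp: l2_def\<close>)

lemma l2_norm_nonneg: "0 \<le> l2_norm \<psi>"
  unfolding l2_norm_def by (simp add: infsum_nonneg)

lemma cmod_le_l2_norm: "\<psi> \<in> l2 \<Longrightarrow> cmod (\<psi> n) \<le> l2_norm \<psi>"
  using L2_set_le_l2_norm[of \<psi> "{n}"] by simp

lemma l2_norm_eq_0: "\<psi> \<in> l2 \<Longrightarrow> l2_norm \<psi> = 0 \<Longrightarrow> \<psi> = (\<lambda>n. 0)"
  using cmod_le_l2_norm[of \<psi>] by fastforce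

lemma l2_norm_sq: "(l2_norm \<psi>)\<^sup>2 = (\<Sum>\<^sub>\<infinity>n. (cmod (\<psi> n))\<^sup>2)"
  unfolding l2_norm_def by (simp add: infsum_nonneg)

lemma l2_dominated:
  assumes "\<phi> \<in> l2" "0 \<le> K" "\<And>n. cmod (\<psi> n) \<le> K * cmod (\<phi> n)"
  shows "\<psi> \<in> l2" and "l2_norm \<psi> \<le> K * l2_norm \<phi>"
proof -
  have "L2_set (\<lambda>n. cmod (\<psi> n)) F \<le> K * l2_norm \<phi>" if "finite F" for F
  proof -
    have "L2_set (\<lambda>n. cmod (\<psi> n)) F \<le> L2_set (\<lambda>n. K * cmod (\<phi> n)) F"
      by (rule L2_set_mono) (use assms in auto)
    also have "\<dots> = K * L2_set (\<lambda>n. cmod (\<phi> n)) F" using assms(2) by (simp add: L2_set_right_distrib)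
    also have "\<dots> \<le> K * l2_norm \<phi>"
      by (intro mult_left_mono L2_set_le_l2_norm assms that)
    finally show ?thesis .
  qed
  then show "\<psi> \<in> l2" and "l2_norm \<psi> \<le> K * l2_norm \<phi>" by (blast intro: l2_by_finite_sums)+
qed

lemma l2_add:
  assumes "\<phi> \<in> l2" "\<psi> \<in> l2"
  shows "(\<lambda>n. \<phi> n + \<psi> n) \<in> l2" and "l2_norm (\<lambda>n. \<phi> n + \<psi> n) \<le> l2_norm \<phi> + l2_norm \<psi>"
proof -
  have "L2_set (\<lambda>n. cmod (\<phi> n + \<psi> n)) F \<le> l2_norm \<phi> + l2_norm \<psi>" if "finite F" for F
  proof -
    have "L2_set (\<lambda>n. cmod (\<phi> n + \<psi> n)) F \<le> L2_set (\<lambda>n. cmod (\<phi> n) + cmod (\<psi> n)) F"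
      by (rule L2_set_mono) (auto simp: norm_triangle_ineq)
    also have "\<dots> \<le> L2_set (\<lambda>n. cmod (\<phi> n)) F + L2_set (\<lambda>n. cmod (\<psi> n)) F"
      by (rule L2_set_triangle_ineq)
    also have "\<dots> \<le> l2_norm \<phi> + l2_norm \<psi>"
      by (intro add_mono L2_set_le_l2_norm assms that)
    finally show ?thesis .
  qed
  then show "(\<lambda>n. \<phi> n + \<psi> n) \<in> l2" "l2_norm (\<lambda>n. \<phi> n + \<psi> n) \<le> l2_norm \<phi> + l2_norm \<psi>"
    by (blast intro: l2_by_finite_sums)+
qed

lemma l2_scale:
  assumes "\<psi> \<in> l2"
  shows "(\<lambda>n. c * \<psi> n) \<in> l2" and "l2_norm (\<lambda>n. c * \<psi> n) = cmod c * l2_norm \<psi>"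
proof -
  show "(\<lambda>n. c * \<psi> n) \<in> l2" by (rule l2_dominated(1)[OF assms, of "cmod c"]) (auto simp: norm_mult)
  have "(\<Sum>\<^sub>\<infinity>n. (cmod (c * \<psi> n))\<^sup>2) = (cmod c)\<^sup>2 * (\<Sum>\<^sub>\<infinity>n. (cmod (\<psi> n))\<^sup>2)"
    by (simp add: norm_mult power_mult_distrib infsum_cmult_right')
  then show "l2_norm (\<lambda>n. c * \<psi> n) = cmod c * l2_norm \<psi>"
    unfolding l2_norm_def by (simp add: real_sqrt_mult)
qed

lemma l2_diff:
  assumes "\<phi> \<in> l2" "\<psi> \<in> l2"
  shows "(\<lambda>n. \<phi> n - \<psi> n) \<in> l2" and "l2_norm (\<lambda>n. \<phi> n - \<psi> n) \<le> l2_norm \<phi> + l2_norm \<psi>"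
  using l2_add[OF assms(1) l2_scale(1)[OF assms(2), of "-1"]] l2_scale(2)[OF assms(2), of "-1"]
  by auto

lemma l2_diff_lower:
  assumes "\<phi> \<in> l2" "\<psi> \<in> l2"
  shows "l2_norm \<phi> - l2_norm \<psi> \<le> l2_norm (\<lambda>n. \<phi> n - \<psi> n)"
  using l2_add(2)[OF l2_diff(1)[OF assms] assms(2)] by simp

lemma l2_zero: "(\<lambda>n. 0) \<in> l2" "l2_norm (\<lambda>n. 0) = 0"
  by (simp_all add: l2_def l2_norm_def)

lemma l2_reindex:
  assumes "bij g" "\<psi> \<in> l2"
  shows "(\<lambda>n. \<psi> (g n)) \<in> l2" and "l2_norm (\<lambda>n. \<psi> (g n)) = l2_norm \<psi>"
  using assms(2) summable_on_reindex_bij_betw[OF assms(1), of "\<lambda>n. (cmod (\<psi> n))\<^sup>2"]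
    infsum_reindex_bij_betw[OF assms(1), of "\<lambda>n. (cmod (\<psi> n))\<^sup>2"]
  by (auto simp: l2_def l2_norm_def)

lemma bij_translation: "bij (\<lambda>n::int. n + k)"
  by (rule bij_betw_byWitness[where f'="\<lambda>n. n - k"]) auto

lemma l2_translate:
  assumes "\<psi> \<in> l2"
  shows "(\<lambda>n. \<psi> (n + k)) \<in> l2" and "l2_norm (\<lambda>n. \<psi> (n + k)) = l2_norm \<psi>"
  using l2_reindex[OF bij_translation assms] by auto

lemma l2_finite_support:
  assumes "finite {n. \<psi> n \<noteq> 0}"
  shows "\<psi> \<in> l2"
proof (rule l2_by_finite_sums(1))
  fix F :: "int set" assume "finite F"
  have "L2_set (\<lambda>n. cmod (\<psi> n)) F \<le> (\<Sum>n\<in>F. cmod (\<psi> n))" by (rule L2_set_le_sum) auto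
  also have "\<dots> = (\<Sum>n\<in>F \<inter> {n. \<psi> n \<noteq> 0}. cmod (\<psi> n))"
    by (rule sum.mono_neutral_right) (use \<open>finite F\<close> in auto)
  also have "\<dots> \<le> (\<Sum>n\<in>{n. \<psi> n \<noteq> 0}. cmod (\<psi> n))"
    by (rule sum_mono2) (use assms in auto)
  finally show "L2_set (\<lambda>n. cmod (\<psi> n)) F \<le> (\<Sum>n\<in>{n. \<psi> n \<noteq> 0}. cmod (\<psi> n))" .
qed

lemma l2_finite_approx:
  assumes "\<psi> \<in> l2" "0 < e"
  shows "\<exists>F. finite F \<and> l2_norm (\<lambda>n. if n \<in> F then 0 else \<psi> n) \<le> e"
proof -
  have s: "(\<lambda>n. (cmod (\<psi> n))\<^sup>2) summable_on UNIV" using assms by (simp add: l2_def)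
  then obtain F where F: "finite F"
    "\<bar>(\<Sum>n\<in>F. (cmod (\<psi> n))\<^sup>2) - (\<Sum>\<^sub>\<infinity>n. (cmod (\<psi> n))\<^sup>2)\<bar> \<le> e\<^sup>2"
    using infsum_finite_approximation[OF s, of "e\<^sup>2"] assms(2) by (auto simp: dist_real_def)
  have "L2_set (\<lambda>n. cmod (if n \<in> F then 0 else \<psi> n)) G \<le> e" if "finite G" for G
  proof -
    have "(\<Sum>n\<in>G. (cmod (if n \<in> F then 0 else \<psi> n))\<^sup>2) = (\<Sum>n\<in>G - F. (cmod (\<psi> n))\<^sup>2)"
      using \<open>finite G\<close> by (intro sum.mono_neutral_cong_right) auto
    also have "\<dots> = (\<Sum>n\<in>G \<union> F. (cmod (\<psi> n))\<^sup>2) - (\<Sum>n\<in>F. (cmod (\<psi> n))\<^sup>2)"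
      using sum_diff[of "G \<union> F" F "\<lambda>n. (cmod (\<psi> n))\<^sup>2"] F(1) \<open>finite G\<close> by (simp add: Un_Diff)
    also have "\<dots> \<le> (\<Sum>\<^sub>\<infinity>n. (cmod (\<psi> n))\<^sup>2) - (\<Sum>n\<in>F. (cmod (\<psi> n))\<^sup>2)"
      using finite_sum_le_infsum[OF s, of "G \<union> F"] F(1) \<open>finite G\<close> by auto
    also have "\<dots> \<le> e\<^sup>2" using F(2) by linarith
    finally show ?thesis unfolding L2_set_def using assms(2) by (simp add: real_le_lsqrt)
  qed
  then have "l2_norm (\<lambda>n. if n \<in> F then 0 else \<psi> n) \<le> e" by (rule l2_by_finite_sums(2))
  then show ?thesis using F(1) by blast
qed

subsection \<open>The real inner product\<close>

text \<open>Only real parts of inner products enter, through the expansion of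
  \<open>l2_norm (\<phi> + t \<psi>)\<close> for real \<open>t\<close>.\<close>

definition re_inner :: "(int \<Rightarrow> complex) \<Rightarrow> (int \<Rightarrow> complex) \<Rightarrow> real" where
  "re_inner \<phi> \<psi> = (\<Sum>\<^sub>\<infinity>n. Re (\<phi> n * cnj (\<psi> n)))"

lemma re_inner_summable:
  assumes "\<phi> \<in> l2" "\<psi> \<in> l2"
  shows "(\<lambda>n. Re (\<phi> n * cnj (\<psi> n))) summable_on UNIV"
proof -
  have *: "norm (Re (\<phi> n * cnj (\<psi> n))) \<le> (cmod (\<phi> n))\<^sup>2 + (cmod (\<psi> n))\<^sup>2" for n
  proof -
    have "\<bar>Re (\<phi> n * cnj (\<psi> n))\<bar> \<le> cmod (\<phi> n) * cmod (\<psi> n)"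
      using abs_Re_le_cmod[of "\<phi> n * cnj (\<psi> n)"] by (simp only: norm_mult complex_mod_cnj)
    also have "\<dots> \<le> (cmod (\<phi> n))\<^sup>2 + (cmod (\<psi> n))\<^sup>2"
      using sum_squares_bound[of "cmod (\<phi> n)" "cmod (\<psi> n)"]
        mult_nonneg_nonneg[OF norm_ge_zero norm_ge_zero, of "\<phi> n" "\<psi> n"] by linarith
    finally show ?thesis by simp
  qed
  have "(\<lambda>n. (cmod (\<phi> n))\<^sup>2 + (cmod (\<psi> n))\<^sup>2) summable_on UNIV"
    using assms by (auto simp: l2_def intro: summable_on_add)
  then have "(\<lambda>n. norm (Re (\<phi> n * cnj (\<psi> n)))) summable_on UNIV"
    by (rule Infinite_Sum.abs_summable_on_comparison_test') (rule *)
  then show ?thesis by (rule abs_summable_summable)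
qed

lemma re_inner_commute: "re_inner \<phi> \<psi> = re_inner \<psi> \<phi>"
  unfolding re_inner_def by (rule infsum_cong) (simp add: mult.commute)

lemma re_inner_self: "re_inner \<psi> \<psi> = (l2_norm \<psi>)\<^sup>2"
  unfolding re_inner_def l2_norm_sq by (rule infsum_cong) (simp add: complex_norm_square[symmetric])

lemma re_inner_add:
  assumes "\<phi> \<in> l2" "\<phi>' \<in> l2" "\<psi> \<in> l2"
  shows "re_inner (\<lambda>n. \<phi> n + \<phi>' n) \<psi> = re_inner \<phi> \<psi> + re_inner \<phi>' \<psi>"
  unfolding re_inner_def
  using infsum_add[OF re_inner_summable[OF assms(1,3)] re_inner_summable[OF assms(2,3)]]
  by (simp add: algebra_simps)

lemma re_inner_scale:
  "re_inner (\<lambda>n. complex_of_real t * \<phi> n) \<psi> = t * re_inner \<phi> \<psi>"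
  unfolding re_inner_def infsum_cmult_right'[symmetric] by (simp add: algebra_simps)

lemma re_inner_mult_left: "re_inner (\<lambda>n. v n * \<phi> n) \<psi> = re_inner \<phi> (\<lambda>n. cnj (v n) * \<psi> n)"
  unfolding re_inner_def by (simp add: algebra_simps)

lemma re_inner_translate:
  "re_inner (\<lambda>n. \<phi> (n + k)) \<psi> = re_inner \<phi> (\<lambda>n. \<psi> (n - k))"
  unfolding re_inner_def
  using infsum_reindex_bij_betw[OF bij_translation, of "\<lambda>n. Re (\<phi> n * cnj (\<psi> (n - k)))" k]
  by simp

lemma l2_norm_add_scaled:
  assumes "\<phi> \<in> l2" "\<psi> \<in> l2"
  shows "(l2_norm (\<lambda>n. \<phi> n + complex_of_real t * \<psi> n))\<^sup>2
           = (l2_norm \<phi>)\<^sup>2 + 2 * t * re_inner \<phi> \<psi> + t\<^sup>2 * (l2_norm \<psi>)\<^sup>2"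
proof -
  let ?\<xi> = "\<lambda>n. complex_of_real t * \<psi> n"
  have \<xi>: "?\<xi> \<in> l2" by (rule l2_scale(1)[OF assms(2)])
  let ?s = "\<lambda>n. \<phi> n + ?\<xi> n"
  have s: "?s \<in> l2" by (rule l2_add(1)[OF assms(1) \<xi>])
  have "(l2_norm ?s)\<^sup>2 = re_inner \<phi> ?s + re_inner ?\<xi> ?s"
    unfolding re_inner_self[symmetric] by (rule re_inner_add[OF assms(1) \<xi> s])
  moreover have "re_inner \<phi> ?s = re_inner \<phi> \<phi> + re_inner ?\<xi> \<phi>"
    using re_inner_add[OF assms(1) \<xi> assms(1)] re_inner_commute[of \<phi> ?s] by linarith
  moreover have "re_inner ?\<xi> ?s = re_inner \<phi> ?\<xi> + re_inner ?\<xi> ?\<xi>"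
    using re_inner_add[OF assms(1) \<xi> \<xi>] re_inner_commute[of ?\<xi> ?s] by linarith
  moreover have "re_inner \<phi> ?\<xi> = re_inner ?\<xi> \<phi>" by (rule re_inner_commute)
  moreover have "re_inner ?\<xi> \<phi> = t * re_inner \<phi> \<psi>"
    unfolding re_inner_scale re_inner_commute[of \<phi> \<psi>] ..
  moreover have "re_inner ?\<xi> ?\<xi> = t\<^sup>2 * (l2_norm \<psi>)\<^sup>2"
    using l2_scale(2)[OF assms(2), of t] by (simp add: re_inner_self power_mult_distrib)
  ultimately show ?thesis by (simp add: re_inner_self)
qed

section \<open>The spectrum of a bounded potential\<close>

definition H_minus :: "(int \<Rightarrow> real) \<Rightarrow> complex \<Rightarrow> (int \<Rightarrow> complex) \<Rightarrow> (int \<Rightarrow> complex)" where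
  "H_minus \<omega> z \<psi> = (\<lambda>n. schrodinger \<omega> \<psi> n - z * \<psi> n)"

definition bounded_below :: "(int \<Rightarrow> real) \<Rightarrow> complex \<Rightarrow> real \<Rightarrow> bool" where
  "bounded_below \<omega> z c \<longleftrightarrow> (\<forall>\<psi>\<in>l2. c * l2_norm \<psi> \<le> l2_norm (H_minus \<omega> z \<psi>))"

lemma H_minus_alt:
  "H_minus \<omega> z \<psi> = (\<lambda>n. \<psi> (n + 1) + \<psi> (n - 1) + (complex_of_real (\<omega> n) - z) * \<psi> n)"
  by (auto simp: H_minus_def schrodinger_def algebra_simps)

lemma H_minus_add: "H_minus \<omega> z (\<lambda>n. \<phi> n + \<psi> n) = (\<lambda>n. H_minus \<omega> z \<phi> n + H_minus \<omega> z \<psi> n)"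
  by (auto simp: H_minus_alt algebra_simps)

lemma H_minus_diff: "H_minus \<omega> z (\<lambda>n. \<phi> n - \<psi> n) = (\<lambda>n. H_minus \<omega> z \<phi> n - H_minus \<omega> z \<psi> n)"
  by (auto simp: H_minus_alt algebra_simps)

lemma H_minus_scale: "H_minus \<omega> z (\<lambda>n. c * \<psi> n) = (\<lambda>n. c * H_minus \<omega> z \<psi> n)"
  by (auto simp: H_minus_alt algebra_simps)

lemma H_minus_sum:
  "finite I \<Longrightarrow> H_minus \<omega> z (\<lambda>n. \<Sum>i\<in>I. d i n) = (\<lambda>n. \<Sum>i\<in>I. H_minus \<omega> z (d i) n)"
  by (auto simp: H_minus_alt sum.distrib sum_distrib_left)

lemma H_minus_l2:
  assumes \<omega>: "\<forall>n. \<bar>\<omega> n\<bar> \<le> C" and \<psi>: "\<psi> \<in> l2"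
  shows "H_minus \<omega> z \<psi> \<in> l2"
    and "l2_norm (H_minus \<omega> z \<psi>) \<le> (2 + C + cmod z) * l2_norm \<psi>"
proof -
  have C: "0 \<le> C" using spec[OF \<omega>, of 0] by linarith
  have a: "(\<lambda>n. \<psi> (n + 1)) \<in> l2" "l2_norm (\<lambda>n. \<psi> (n + 1)) = l2_norm \<psi>"
    using l2_translate[OF \<psi>] by auto
  have b: "(\<lambda>n. \<psi> (n - 1)) \<in> l2" "l2_norm (\<lambda>n. \<psi> (n - 1)) = l2_norm \<psi>"
    using l2_translate[OF \<psi>, of "-1"] by auto
  have "cmod ((complex_of_real (\<omega> n) - z) * \<psi> n) \<le> (C + cmod z) * cmod (\<psi> n)" for n
    unfolding norm_mult
    using norm_triangle_ineq4[of "complex_of_real (\<omega> n)" z] spec[OF \<omega>, of n]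
    by (intro mult_right_mono) auto
  then have c: "(\<lambda>n. (complex_of_real (\<omega> n) - z) * \<psi> n) \<in> l2"
    "l2_norm (\<lambda>n. (complex_of_real (\<omega> n) - z) * \<psi> n) \<le> (C + cmod z) * l2_norm \<psi>"
    using l2_dominated[OF \<psi>, of "C + cmod z"] C by auto
  note ab = l2_add[OF a(1) b(1)]
  note abc = l2_add[OF ab(1) c(1)]
  show "H_minus \<omega> z \<psi> \<in> l2" using abc(1) by (simp add: H_minus_alt)
  show "l2_norm (H_minus \<omega> z \<psi>) \<le> (2 + C + cmod z) * l2_norm \<psi>"
    using abc(2) ab(2) a(2) b(2) c(2) by (simp add: H_minus_alt algebra_simps)
qed

lemma H_minus_adjoint:
  assumes \<omega>: "\<forall>n. \<bar>\<omega> n\<bar> \<le> C" and \<phi>: "\<phi> \<in> l2" and \<psi>: "\<psi> \<in> l2"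
  shows "re_inner (H_minus \<omega> z \<phi>) \<psi> = re_inner \<phi> (H_minus \<omega> (cnj z) \<psi>)"
proof -
  let ?v = "\<lambda>n. complex_of_real (\<omega> n) - z"
  have l2: "(\<lambda>n. \<xi> (n + 1)) \<in> l2" "(\<lambda>n. \<xi> (n - 1)) \<in> l2" 
    "(\<lambda>n. \<xi> (n + 1) + \<xi> (n - 1)) \<in> l2" 
    "(\<lambda>n. (complex_of_real (\<omega> n) - x) * \<xi> n) \<in> l2" if "\<xi> \<in> l2" for \<xi> x
  proof -
    show 1: "(\<lambda>n. \<xi> (n + 1)) \<in> l2" "(\<lambda>n. \<xi> (n - 1)) \<in> l2"
      using l2_translate[OF that, of 1] l2_translate[OF that, of "-1"] by auto
    show 2: "(\<lambda>n. \<xi> (n + 1) + \<xi> (n - 1)) \<in> l2" using l2_add(1)[OF 1] .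
    show "(\<lambda>n. (complex_of_real (\<omega> n) - x) * \<xi> n) \<in> l2"
      using l2_diff(1)[OF H_minus_l2(1)[OF \<omega> that, of x] 2] by (simp add: H_minus_alt)
  qed
  have e: "re_inner (H_minus \<omega> x \<phi>) \<psi> = re_inner (\<lambda>n. \<phi> (n + 1)) \<psi>
      + re_inner (\<lambda>n. \<phi> (n - 1)) \<psi> + re_inner (\<lambda>n. (complex_of_real (\<omega> n) - x) * \<phi> n) \<psi>"
    if "\<phi> \<in> l2" "\<psi> \<in> l2" for \<phi> \<psi> x
    using re_inner_add[OF l2(3)[OF that(1)] l2(4)[OF that(1)] that(2)]
      re_inner_add[OF l2(1,2)[OF that(1)] that(2)] by (simp add: H_minus_alt)
  have "re_inner \<phi> (H_minus \<omega> (cnj z) \<psi>) = re_inner \<phi> (\<lambda>n. \<psi> (n + 1))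
      + re_inner \<phi> (\<lambda>n. \<psi> (n - 1)) + re_inner \<phi> (\<lambda>n. cnj (?v n) * \<psi> n)"
    using e[OF \<psi> \<phi>, of "cnj z"] unfolding re_inner_commute[of _ \<phi>] by simp
  then show ?thesis
    using re_inner_translate[of \<phi> 1 \<psi>] re_inner_translate[of \<phi> "-1" \<psi>]
      re_inner_mult_left[of ?v \<phi> \<psi>] e[OF \<phi> \<psi>, of z] by simp
qed

text \<open>The potential is real, so complex conjugation exchanges \<open>H - z\<close> and its adjoint
  \<open>H - cnj z\<close> without changing norms: one of them is bounded below iff the other is.\<close>

lemma bounded_below_cnj:
  assumes "bounded_below \<omega> z c"
  shows "bounded_below \<omega> (cnj z) c"
  unfolding bounded_below_def
proof
  fix \<psi> :: "int \<Rightarrow> complex" assume "\<psi> \<in> l2"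
  then have "(\<lambda>n. cnj (\<psi> n)) \<in> l2" by (simp add: l2_def)
  then have "c * l2_norm (\<lambda>n. cnj (\<psi> n)) \<le> l2_norm (H_minus \<omega> z (\<lambda>n. cnj (\<psi> n)))"
    using assms by (simp add: bounded_below_def)
  moreover have "H_minus \<omega> z (\<lambda>n. cnj (\<psi> n)) = (\<lambda>n. cnj (H_minus \<omega> (cnj z) \<psi> n))"
    by (simp add: H_minus_alt)
  ultimately show "c * l2_norm \<psi> \<le> l2_norm (H_minus \<omega> (cnj z) \<psi>)" by (simp add: l2_norm_def)
qed

text \<open>If \<open>T = H - z\<close> and its adjoint \<open>T*\<close> are bounded below by \<open>c\<close>, then \<open>T T*\<close> is a positive
  operator bounded below by \<open>c\<^sup>2\<close>, so for small \<open>\<tau>\<close> the map \<open>1 - \<tau> T T*\<close> is a strict contraction.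
  Its Neumann series solves \<open>T T* \<phi> = f\<close>; since \<open>T T*\<close> is a finite difference operator, the equation
  survives the pointwise limit.\<close>

lemma H_minus_surj:
  assumes \<omega>: "\<forall>n. \<bar>\<omega> n\<bar> \<le> C" and c: "0 < c" and bb: "bounded_below \<omega> z c" and f: "f \<in> l2"
  shows "\<exists>\<psi>\<in>l2. H_minus \<omega> z \<psi> = f"
proof -
  define T where "T = H_minus \<omega> z"
  define S where "S = H_minus \<omega> (cnj z)"
  define K where "K = 2 + C + cmod z"
  have K: "K > 0" using spec[OF \<omega>, of 0] norm_ge_zero[of z] unfolding K_def by linarith
  have T: "T \<psi> \<in> l2" "l2_norm (T \<psi>) \<le> K * l2_norm \<psi>" if "\<psi> \<in> l2" for \<psi>
    using H_minus_l2[OF \<omega> that, of z] by (auto simp: T_def K_def)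
  have S: "S \<psi> \<in> l2" "l2_norm (S \<psi>) \<le> K * l2_norm \<psi>" "c * l2_norm \<psi> \<le> l2_norm (S \<psi>)"
    if "\<psi> \<in> l2" for \<psi>
    using H_minus_l2[OF \<omega> that, of "cnj z"] bounded_below_cnj[OF bb] that
    by (auto simp: S_def K_def bounded_below_def)
  \<comment> \<open>this \<open>\<tau>\<close> minimises the bound \<open>1 - 2 \<tau> c\<^sup>2 + \<tau>\<^sup>2 K\<^sup>4\<close> for the squared contraction factor\<close>
  define \<tau> where "\<tau> = c\<^sup>2 / K^4"
  have \<tau>: "\<tau> > 0" using c K by (simp add: \<tau>_def)
  define q where "q = sqrt (max 0 (1 - c^4 / K^4))"
  have q: "0 \<le> q" "q < 1" using c K by (auto simp: q_def real_sqrt_lt_1_iff)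
  have contr: "l2_norm (\<lambda>n. \<phi> n - \<tau> * T (S \<phi>) n) \<le> q * l2_norm \<phi>" if \<phi>: "\<phi> \<in> l2" for \<phi>
  proof -
    have "(l2_norm (\<lambda>n. \<phi> n - \<tau> * T (S \<phi>) n))\<^sup>2
        = (l2_norm \<phi>)\<^sup>2 - 2 * \<tau> * re_inner \<phi> (T (S \<phi>)) + \<tau>\<^sup>2 * (l2_norm (T (S \<phi>)))\<^sup>2"
      using l2_norm_add_scaled[OF \<phi> T(1)[OF S(1)[OF \<phi>]], of "-\<tau>"] by simp
    also have "re_inner \<phi> (T (S \<phi>)) = (l2_norm (S \<phi>))\<^sup>2"
      using H_minus_adjoint[OF \<omega> S(1)[OF \<phi>] \<phi>, of z]
      unfolding re_inner_commute[of \<phi> "T (S \<phi>)"] by (simp add: re_inner_self T_def S_def)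
    also have "(l2_norm \<phi>)\<^sup>2 - 2 * \<tau> * (l2_norm (S \<phi>))\<^sup>2 + \<tau>\<^sup>2 * (l2_norm (T (S \<phi>)))\<^sup>2
        \<le> (l2_norm \<phi>)\<^sup>2 - 2 * \<tau> * (c * l2_norm \<phi>)\<^sup>2 + \<tau>\<^sup>2 * (K * (K * l2_norm \<phi>))\<^sup>2"
    proof -
      have "(c * l2_norm \<phi>)\<^sup>2 \<le> (l2_norm (S \<phi>))\<^sup>2"
        using S(3)[OF \<phi>] c l2_norm_nonneg[of \<phi>] by (intro power_mono) auto
      moreover have "l2_norm (T (S \<phi>)) \<le> K * (K * l2_norm \<phi>)"
        using T(2)[OF S(1)[OF \<phi>]] mult_left_mono[OF S(2)[OF \<phi>], of K] K by linarith
      then have "(l2_norm (T (S \<phi>)))\<^sup>2 \<le> (K * (K * l2_norm \<phi>))\<^sup>2"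
        using l2_norm_nonneg by (intro power_mono) auto
      ultimately show ?thesis using \<tau>
        by (intro add_mono diff_mono mult_left_mono) auto
    qed
    also have "\<dots> = (1 - 2 * \<tau> * c\<^sup>2 + \<tau>\<^sup>2 * K^4) * (l2_norm \<phi>)\<^sup>2"
      by (simp add: algebra_simps power_mult_distrib power2_eq_square power4_eq_xxxx)
    also have "1 - 2 * \<tau> * c\<^sup>2 + \<tau>\<^sup>2 * K^4 = 1 - c^4 / K^4"
      using K by (simp add: \<tau>_def field_simps power2_eq_square power4_eq_xxxx)
    also have "(1 - c^4 / K^4) * (l2_norm \<phi>)\<^sup>2 \<le> q\<^sup>2 * (l2_norm \<phi>)\<^sup>2"
      unfolding q_def by (intro mult_right_mono) auto
    also have "\<dots> = (q * l2_norm \<phi>)\<^sup>2" by (simp add: power_mult_distrib)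
    finally show ?thesis
      by (rule power2_le_imp_le) (use q l2_norm_nonneg in auto)
  qed
  define d where "d = rec_nat (\<lambda>n. complex_of_real \<tau> * f n) (\<lambda>_ \<phi> n. \<phi> n - \<tau> * T (S \<phi>) n)"
  have d0: "d 0 = (\<lambda>n. complex_of_real \<tau> * f n)"
    and dS: "\<And>i. d (Suc i) = (\<lambda>n. d i n - complex_of_real \<tau> * T (S (d i)) n)" by (simp_all add: d_def)
  have d: "d i \<in> l2 \<and> l2_norm (d i) \<le> q ^ i * (\<tau> * l2_norm f)" for i
  proof (induction i)
    case 0
    then show ?case using l2_scale[OF f, of \<tau>] \<tau> by (simp add: d0)
  next
    case (Suc i)
    then have "d (Suc i) \<in> l2" unfolding dS
      by (intro l2_diff(1) l2_scale(1) T S) auto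
    moreover have "l2_norm (d (Suc i)) \<le> q * l2_norm (d i)" using contr Suc by (simp add: dS)
    moreover have "q * l2_norm (d i) \<le> q * (q ^ i * (\<tau> * l2_norm f))"
      using Suc q by (intro mult_left_mono) auto
    ultimately show ?case by simp
  qed
  define M where "M = \<tau> * l2_norm f"
  have M: "M \<ge> 0" using \<tau> l2_norm_nonneg by (simp add: M_def)
  have geo: "summable (\<lambda>i. q ^ i * M)" using q by (intro summable_mult2 summable_geometric) auto
  have dn: "cmod (d i n) \<le> q ^ i * M" for i n
    using d[of i] cmod_le_l2_norm[of "d i" n] by (auto simp: M_def)
  have sd: "summable (\<lambda>i. d i n)" for n
    by (rule summable_comparison_test'[OF geo, of 0]) (use dn in auto)
  define s where "s N = (\<lambda>n. \<Sum>i<N. d i n)" for N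
  define \<phi> where "\<phi> n = (\<Sum>i. d i n)" for n
  have lim: "(\<lambda>N. s N n) \<longlonglongrightarrow> \<phi> n" for n
    unfolding s_def \<phi>_def using sd summable_LIMSEQ by blast
  have s: "s N \<in> l2 \<and> l2_norm (s N) \<le> (\<Sum>i<N. q ^ i * M)" for N
  proof (induction N)
    case 0
    then show ?case using l2_zero by (simp add: s_def)
  next
    case (Suc N)
    have "s (Suc N) = (\<lambda>n. s N n + d N n)" by (simp add: s_def)
    then show ?case using l2_add[of "s N" "d N"] d[of N] Suc by (auto simp: M_def)
  qed
  have "L2_set (\<lambda>n. cmod (\<phi> n)) F \<le> (\<Sum>i. q ^ i * M)" if "finite F" for F
  proof (rule LIMSEQ_le_const2)
    show "(\<lambda>N. L2_set (\<lambda>n. cmod (s N n)) F) \<longlonglongrightarrow> L2_set (\<lambda>n. cmod (\<phi> n)) F"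
      unfolding L2_set_def by (intro tendsto_intros lim)
    have "L2_set (\<lambda>n. cmod (s N n)) F \<le> (\<Sum>i. q ^ i * M)" for N
    proof -
      have "(\<Sum>i<N. q ^ i * M) \<le> (\<Sum>i. q ^ i * M)"
        by (rule sum_le_suminf[OF geo]) (use q M in auto)
      then show ?thesis using L2_set_le_l2_norm[of "s N" F] s[of N] that by force
    qed
    then show "\<exists>N. \<forall>n\<ge>N. L2_set (\<lambda>m. cmod (s n m)) F \<le> (\<Sum>i. q ^ i * M)" by blast
  qed
  then have \<phi>: "\<phi> \<in> l2" by (rule l2_by_finite_sums(1))
  have "T (S \<phi>) n = f n" for n
  proof -
    \<comment> \<open>the partial sums telescope: \<open>\<tau> T T* d\<^sub>i = d\<^sub>i - d\<^sub>i\<^sub>+\<^sub>1\<close>\<close>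
    have "T (S (s N)) n = (d 0 n - d N n) / \<tau>" for N
    proof -
      have "T (S (s N)) n = (\<Sum>i<N. T (S (d i)) n)"
        by (simp add: s_def T_def S_def H_minus_sum)
      also have "\<dots> = (\<Sum>i<N. (d i n - d (Suc i) n) / \<tau>)"
        using \<tau> by (intro sum.cong) (auto simp: dS)
      also have "\<dots> = (d 0 n - d N n) / \<tau>"
        unfolding sum_divide_distrib[symmetric] sum_lessThan_telescope'[of "\<lambda>i. d i n"] ..
      finally show ?thesis .
    qed
    moreover have "(\<lambda>N. (d 0 n - d N n) / \<tau>) \<longlonglongrightarrow> (d 0 n - 0) / \<tau>"
      by (intro tendsto_intros summable_LIMSEQ_zero sd) (use \<tau> in auto)
    ultimately have "(\<lambda>N. T (S (s N)) n) \<longlonglongrightarrow> f n" using \<tau> by (simp add: d0)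
    moreover have "(\<lambda>N. T (S (s N)) n) \<longlonglongrightarrow> T (S \<phi>) n"
      unfolding T_def S_def H_minus_alt by (intro tendsto_intros lim)
    ultimately show ?thesis using LIMSEQ_unique by blast
  qed
  then show ?thesis using S(1)[OF \<phi>] by (auto simp: T_def intro!: bexI[of _ "S \<phi>"])
qed

lemma spectrum_iff_not_bounded_below:
  assumes \<omega>: "\<forall>n. \<bar>\<omega> n\<bar> \<le> C"
  shows "z \<in> spectrum (schrodinger \<omega>) \<longleftrightarrow> \<not> (\<exists>c>0. bounded_below \<omega> z c)"
proof -
  have "(\<exists>R. bounded_operator R \<and> (\<forall>\<psi>\<in>l2. R (H_minus \<omega> z \<psi>) = \<psi> \<and> H_minus \<omega> z (R \<psi>) = \<psi>))
      \<longleftrightarrow> (\<exists>c>0. bounded_below \<omega> z c)"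
  proof
    assume "\<exists>R. bounded_operator R \<and> (\<forall>\<psi>\<in>l2. R (H_minus \<omega> z \<psi>) = \<psi> \<and> H_minus \<omega> z (R \<psi>) = \<psi>)"
    then obtain R D where R: "\<forall>\<psi>\<in>l2. l2_norm (R \<psi>) \<le> D * l2_norm \<psi>"
      "\<forall>\<psi>\<in>l2. R (H_minus \<omega> z \<psi>) = \<psi>"
      by (auto simp: bounded_operator_def)
    define c where "c = 1 / max D 1"
    have "c * l2_norm \<psi> \<le> l2_norm (H_minus \<omega> z \<psi>)" if "\<psi> \<in> l2" for \<psi>
    proof -
      have "l2_norm \<psi> \<le> D * l2_norm (H_minus \<omega> z \<psi>)"
        using R H_minus_l2(1)[OF \<omega> that] that by metis
      also have "\<dots> \<le> max D 1 * l2_norm (H_minus \<omega> z \<psi>)"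
        by (intro mult_right_mono l2_norm_nonneg) auto
      finally show ?thesis by (simp add: c_def field_simps)
    qed
    moreover have "c > 0" by (simp add: c_def)
    ultimately show "\<exists>c>0. bounded_below \<omega> z c" by (auto simp: bounded_below_def)
  next
    assume "\<exists>c>0. bounded_below \<omega> z c"
    then obtain c where c: "c > 0" and bb: "bounded_below \<omega> z c" by blast
    define R where "R f = (SOME \<psi>. \<psi> \<in> l2 \<and> H_minus \<omega> z \<psi> = f)" for f
    have R: "R f \<in> l2 \<and> H_minus \<omega> z (R f) = f" if "f \<in> l2" for f
      using someI_ex[of "\<lambda>\<psi>. \<psi> \<in> l2 \<and> H_minus \<omega> z \<psi> = f"] H_minus_surj[OF \<omega> c bb that]
      unfolding R_def by blast
    have inj: "\<phi> = \<psi>" if "\<phi> \<in> l2" "\<psi> \<in> l2" "H_minus \<omega> z \<phi> = H_minus \<omega> z \<psi>" for \<phi> \<psi>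
    proof -
      have "c * l2_norm (\<lambda>n. \<phi> n - \<psi> n) \<le> l2_norm (H_minus \<omega> z (\<lambda>n. \<phi> n - \<psi> n))"
        using bb l2_diff(1)[OF that(1,2)] by (auto simp: bounded_below_def)
      also have "\<dots> = 0" using that(3) l2_zero by (simp add: H_minus_diff)
      finally have "l2_norm (\<lambda>n. \<phi> n - \<psi> n) = 0"
        using c l2_norm_nonneg[of "\<lambda>n. \<phi> n - \<psi> n"] by (simp add: mult_le_0_iff)
      then have "(\<lambda>n. \<phi> n - \<psi> n) = (\<lambda>n. 0)"
        using l2_norm_eq_0[OF l2_diff(1)[OF that(1,2)]] by blast
      then show ?thesis by (metis eq_iff_diff_eq_0 ext)
    qed
    have "bounded_operator R"
      unfolding bounded_operator_def
    proof (intro conjI ballI allI)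
      fix \<psi> assume "\<psi> \<in> l2" then show "R \<psi> \<in> l2" using R by blast
    next
      fix \<phi> \<psi> assume *: "\<phi> \<in> l2" "\<psi> \<in> l2"
      show "R (\<lambda>n. \<phi> n + \<psi> n) = (\<lambda>n. R \<phi> n + R \<psi> n)"
        by (rule inj) (use * R in \<open>auto simp: H_minus_add intro!: l2_add(1)\<close>)
    next
      fix x \<psi> assume *: "\<psi> \<in> l2"
      show "R (\<lambda>n. x * \<psi> n) = (\<lambda>n. x * R \<psi> n)"
        by (rule inj) (use * R in \<open>auto simp: H_minus_scale intro!: l2_scale(1)\<close>)
    next
      show "\<exists>D. \<forall>\<psi>\<in>l2. l2_norm (R \<psi>) \<le> D * l2_norm \<psi>"
      proof (intro exI ballI)
        fix \<psi> assume "\<psi> \<in> l2"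
        then have "c * l2_norm (R \<psi>) \<le> l2_norm \<psi>"
          using bb R[of \<psi>] unfolding bounded_below_def by force
        then show "l2_norm (R \<psi>) \<le> (1 / c) * l2_norm \<psi>" using c by (simp add: field_simps)
      qed
    qed
    moreover have "R (H_minus \<omega> z \<psi>) = \<psi>" if "\<psi> \<in> l2" for \<psi>
      by (rule inj) (use R[OF H_minus_l2(1)[OF \<omega> that]] that in auto)
    ultimately show "\<exists>R. bounded_operator R
        \<and> (\<forall>\<psi>\<in>l2. R (H_minus \<omega> z \<psi>) = \<psi> \<and> H_minus \<omega> z (R \<psi>) = \<psi>)"
      using R by blast
  qed
  then show ?thesis unfolding spectrum_def mem_Collect_eq H_minus_def by (rule arg_cong[of _ _ Not])
qed

text \<open>Expanding \<open>(H - x) \<psi> - i y \<psi>\<close> by the inner product, the cross term is proportional to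
  the imaginary part of a quadratic form of the symmetric operator \<open>H - x\<close>, hence zero.\<close>

lemma bounded_below_nonreal:
  assumes \<omega>: "\<forall>n. \<bar>\<omega> n\<bar> \<le> C"
  shows "bounded_below \<omega> z \<bar>Im z\<bar>"
  unfolding bounded_below_def
proof
  fix \<psi> assume \<psi>: "\<psi> \<in> l2"
  define x where "x = complex_of_real (Re z)"
  let ?i\<psi> = "\<lambda>n. \<i> * \<psi> n"
  have i: "?i\<psi> \<in> l2" "l2_norm ?i\<psi> = l2_norm \<psi>" using l2_scale[OF \<psi>, of \<i>] by auto
  have H: "H_minus \<omega> x \<psi> \<in> l2" by (rule H_minus_l2(1)[OF \<omega> \<psi>])
  have "re_inner (H_minus \<omega> x \<psi>) ?i\<psi> = re_inner \<psi> (\<lambda>n. \<i> * H_minus \<omega> x \<psi> n)"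
    using H_minus_adjoint[OF \<omega> \<psi> i(1), of x] by (simp add: H_minus_scale x_def)
  also have "\<dots> = - re_inner ?i\<psi> (H_minus \<omega> x \<psi>)"
    using re_inner_scale[of "-1" ?i\<psi> "H_minus \<omega> x \<psi>"] re_inner_mult_left[of "\<lambda>n. -\<i>" \<psi> "H_minus \<omega> x \<psi>"]
    by simp
  finally have 0: "re_inner (H_minus \<omega> x \<psi>) ?i\<psi> = 0"
    using re_inner_commute[of "H_minus \<omega> x \<psi>" ?i\<psi>] by linarith
  have *: "z * w = x * w + of_real (Im z) * (\<i> * w)" for w by (simp add: x_def complex_eq_iff)
  have "H_minus \<omega> z \<psi> = (\<lambda>n. H_minus \<omega> x \<psi> n + of_real (- Im z) * ?i\<psi> n)"
    by (simp add: H_minus_alt fun_eq_iff left_diff_distrib *)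
  then have "(l2_norm (H_minus \<omega> z \<psi>))\<^sup>2 = (l2_norm (H_minus \<omega> x \<psi>))\<^sup>2 + (Im z)\<^sup>2 * (l2_norm \<psi>)\<^sup>2"
    using l2_norm_add_scaled[OF H i(1), of "- Im z"] 0 i(2) by simp
  then have "(\<bar>Im z\<bar> * l2_norm \<psi>)\<^sup>2 \<le> (l2_norm (H_minus \<omega> z \<psi>))\<^sup>2"
    by (simp add: power_mult_distrib)
  then show "\<bar>Im z\<bar> * l2_norm \<psi> \<le> l2_norm (H_minus \<omega> z \<psi>)"
    by (rule power2_le_imp_le) (rule l2_norm_nonneg)
qed

lemma bounded_below_perturb:
  assumes \<omega>: "\<forall>n. \<bar>\<omega> n\<bar> \<le> C" and "bounded_below \<omega> z c"
  shows "bounded_below \<omega> z' (c - cmod (z' - z))"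
  unfolding bounded_below_def
proof
  fix \<psi> assume \<psi>: "\<psi> \<in> l2"
  have "H_minus \<omega> z' \<psi> = (\<lambda>n. H_minus \<omega> z \<psi> n - (z' - z) * \<psi> n)"
    by (auto simp: H_minus_alt algebra_simps)
  then have "l2_norm (H_minus \<omega> z \<psi>) - cmod (z' - z) * l2_norm \<psi> \<le> l2_norm (H_minus \<omega> z' \<psi>)"
    using l2_diff_lower[OF H_minus_l2(1)[OF \<omega> \<psi>] l2_scale(1)[OF \<psi>], of z "z' - z"] l2_scale(2)[OF \<psi>]
    by simp
  then show "(c - cmod (z' - z)) * l2_norm \<psi> \<le> l2_norm (H_minus \<omega> z' \<psi>)"
    using assms(2) \<psi> by (auto simp: bounded_below_def algebra_simps)
qed

lemma bounded_below_large:
  assumes \<omega>: "\<forall>n. \<bar>\<omega> n\<bar> \<le> C"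
  shows "bounded_below \<omega> z (cmod z - (2 + C))"
  unfolding bounded_below_def
proof
  fix \<psi> assume \<psi>: "\<psi> \<in> l2"
  have "(\<lambda>n. z * \<psi> n - H_minus \<omega> 0 \<psi> n) = (\<lambda>n. (-1) * H_minus \<omega> z \<psi> n)"
    by (auto simp: H_minus_alt algebra_simps)
  then have "l2_norm (\<lambda>n. z * \<psi> n - H_minus \<omega> 0 \<psi> n) = l2_norm (H_minus \<omega> z \<psi>)"
    using l2_scale(2)[OF H_minus_l2(1)[OF \<omega> \<psi>], of "-1" z] by simp
  then have "cmod z * l2_norm \<psi> - l2_norm (H_minus \<omega> 0 \<psi>) \<le> l2_norm (H_minus \<omega> z \<psi>)"
    using l2_diff_lower[OF l2_scale(1)[OF \<psi>] H_minus_l2(1)[OF \<omega> \<psi>], of z 0] l2_scale(2)[OF \<psi>]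
    by simp
  then show "(cmod z - (2 + C)) * l2_norm \<psi> \<le> l2_norm (H_minus \<omega> z \<psi>)"
    using H_minus_l2(2)[OF \<omega> \<psi>, of 0] by (simp add: algebra_simps)
qed

lemma compact_real_spectrum:
  assumes \<omega>: "\<forall>n. \<bar>\<omega> n\<bar> \<le> C"
  shows "\<exists>\<Sigma>. compact \<Sigma> \<and> spectrum (schrodinger \<omega>) = complex_of_real ` \<Sigma>"
proof -
  note spec = spectrum_iff_not_bounded_below[OF \<omega>]
  define \<Sigma> where "\<Sigma> = {x. complex_of_real x \<in> spectrum (schrodinger \<omega>)}"
  have "\<bar>x\<bar> \<le> 2 + C" if "x \<in> \<Sigma>" for x
  proof (rule ccontr)
    assume "\<not> \<bar>x\<bar> \<le> 2 + C"
    then have "0 < cmod (complex_of_real x) - (2 + C)" by simp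
    then show False using bounded_below_large[OF \<omega>, of "complex_of_real x"] that spec
      by (auto simp: \<Sigma>_def)
  qed
  then have "bounded \<Sigma>" by (auto simp: bounded_iff)
  moreover have "open (- \<Sigma>)"
    unfolding open_dist
  proof
    fix x assume "x \<in> - \<Sigma>"
    then obtain c where c: "c > 0" "bounded_below \<omega> x c" by (auto simp: \<Sigma>_def spec)
    have "y \<in> - \<Sigma>" if "dist y x < c" for y
    proof -
      have "0 < c - cmod (complex_of_real y - complex_of_real x)"
        using that by (simp add: dist_real_def flip: of_real_diff)
      then have "\<exists>d>0. bounded_below \<omega> (complex_of_real y) d"
        using bounded_below_perturb[OF \<omega> c(2), of "complex_of_real y"] by blast
      then show ?thesis by (simp add: \<Sigma>_def spec)
    qed
    then show "\<exists>e>0. \<forall>y. dist y x < e \<longrightarrow> y \<in> - \<Sigma>" using c(1) by blast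
  qed
  ultimately have "compact \<Sigma>" by (simp add: compact_eq_bounded_closed closed_def)
  moreover have "Im z = 0" if "z \<in> spectrum (schrodinger \<omega>)" for z
    using bounded_below_nonreal[OF \<omega>, of z] that spec by (metis zero_less_abs_iff)
  then have "spectrum (schrodinger \<omega>) = complex_of_real ` \<Sigma>"
    unfolding \<Sigma>_def by (auto simp: image_iff) (metis complex_is_Real_iff of_real_Re)
  ultimately show ?thesis by blast
qed

text \<open>By density of finitely supported sequences, a lower bound is decided on finite windows of
  the potential, so it passes to every sequence all of whose windows occur in \<open>\<omega>\<close>.\<close>

lemma bounded_below_transfer:
  assumes \<omega>: "\<forall>n. \<bar>\<omega> n\<bar> \<le> C" and \<omega>': "\<forall>n. \<bar>\<omega>' n\<bar> \<le> C" and bb: "bounded_below \<omega> z c"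
    and c: "c \<ge> 0"
    and occ: "\<And>m::nat. \<exists>k. \<forall>n. \<bar>n\<bar> \<le> int m \<longrightarrow> \<omega>' n = \<omega> (n + k)"
  shows "bounded_below \<omega>' z c"
proof -
  have fin: "c * l2_norm \<psi> \<le> l2_norm (H_minus \<omega>' z \<psi>)" if "finite {n. \<psi> n \<noteq> 0}" for \<psi>
  proof -
    obtain m where m: "\<And>n. \<psi> n \<noteq> 0 \<Longrightarrow> \<bar>n\<bar> \<le> int m"
    proof -
      have "\<bar>n\<bar> \<le> int (nat (Max (abs ` {n. \<psi> n \<noteq> 0})))" if "\<psi> n \<noteq> 0" for n
        using Max_ge[OF finite_imageI[OF \<open>finite {n. \<psi> n \<noteq> 0}\<close>], of "\<bar>n\<bar>" abs] that by auto
      then show ?thesis using that by blast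
    qed
    obtain k where k: "\<And>n. \<bar>n\<bar> \<le> int m \<Longrightarrow> \<omega>' n = \<omega> (n + k)" using occ[of m] by blast
    have \<psi>: "\<psi> \<in> l2" by (rule l2_finite_support[OF that])
    define \<phi> where "\<phi> = (\<lambda>n. \<psi> (n - k))"
    have \<phi>: "\<phi> \<in> l2" "l2_norm \<phi> = l2_norm \<psi>" using l2_translate[OF \<psi>, of "-k"] by (auto simp: \<phi>_def)
    have "H_minus \<omega>' z \<psi> = (\<lambda>n. H_minus \<omega> z \<phi> (n + k))"
    proof
      fix n
      have "\<omega>' n = \<omega> (n + k)" if "\<psi> n \<noteq> 0" using m k that by blast
      then show "H_minus \<omega>' z \<psi> n = H_minus \<omega> z \<phi> (n + k)"
        by (cases "\<psi> n = 0") (auto simp: H_minus_alt \<phi>_def algebra_simps)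
    qed
    then have "l2_norm (H_minus \<omega>' z \<psi>) = l2_norm (H_minus \<omega> z \<phi>)"
      using l2_translate(2)[OF H_minus_l2(1)[OF \<omega> \<phi>(1)]] by simp
    then show ?thesis using bb \<phi> by (auto simp: bounded_below_def)
  qed
  show ?thesis
    unfolding bounded_below_def
  proof
    fix \<psi> assume \<psi>: "\<psi> \<in> l2"
    define D where "D = c + (2 + C + cmod z)"
    have D: "D > 0" using c spec[OF \<omega>, of 0] norm_ge_zero[of z] unfolding D_def by linarith
    show "c * l2_norm \<psi> \<le> l2_norm (H_minus \<omega>' z \<psi>)"
    proof (rule field_le_epsilon)
      fix e :: real assume e: "e > 0"
      obtain F where F: "finite F" "l2_norm (\<lambda>n. if n \<in> F then 0 else \<psi> n) \<le> e / D"
        using l2_finite_approx[OF \<psi>, of "e / D"] e D by auto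
      define \<rho> where "\<rho> = (\<lambda>n. if n \<in> F then 0 else \<psi> n)"
      define \<phi> where "\<phi> = (\<lambda>n. if n \<in> F then \<psi> n else 0)"
      have \<rho>: "\<rho> \<in> l2" by (rule l2_dominated(1)[OF \<psi>, of 1]) (auto simp: \<rho>_def)
      have s: "finite {n. \<phi> n \<noteq> 0}" by (rule finite_subset[OF _ F(1)]) (auto simp: \<phi>_def)
      have \<phi>: "\<phi> \<in> l2" by (rule l2_finite_support[OF s])
      have eq: "\<psi> = (\<lambda>n. \<phi> n + \<rho> n)" "\<phi> = (\<lambda>n. \<psi> n - \<rho> n)" by (auto simp: \<phi>_def \<rho>_def)
      have "c * l2_norm \<psi> \<le> c * (l2_norm \<phi> + l2_norm \<rho>)"
        using l2_add(2)[OF \<phi> \<rho>] c eq(1) by (intro mult_left_mono) auto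
      also have "\<dots> \<le> l2_norm (H_minus \<omega>' z \<phi>) + c * l2_norm \<rho>" using fin[OF s] by (simp add: algebra_simps)
      also have "l2_norm (H_minus \<omega>' z \<phi>) \<le> l2_norm (H_minus \<omega>' z \<psi>) + l2_norm (H_minus \<omega>' z \<rho>)"
        using l2_diff(2)[OF H_minus_l2(1)[OF \<omega>' \<psi>] H_minus_l2(1)[OF \<omega>' \<rho>], of z z]
        by (subst eq(2)) (simp add: H_minus_diff)
      also have "l2_norm (H_minus \<omega>' z \<rho>) \<le> (2 + C + cmod z) * l2_norm \<rho>" by (rule H_minus_l2(2)[OF \<omega>' \<rho>])
      finally have "c * l2_norm \<psi> \<le> l2_norm (H_minus \<omega>' z \<psi>) + D * l2_norm \<rho>"
        by (simp add: D_def algebra_simps)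
      moreover have "D * l2_norm \<rho> \<le> e" using F(2) D by (simp add: \<rho>_def field_simps)
      ultimately show "c * l2_norm \<psi> \<le> l2_norm (H_minus \<omega>' z \<psi>) + e" by linarith
    qed
  qed
qed

section \<open>Subshifts given by a language\<close>

definition window :: "(int \<Rightarrow> 'a) \<Rightarrow> int \<Rightarrow> nat \<Rightarrow> 'a list" where
  "window \<omega> i n = map (\<lambda>j. \<omega> (i + int j)) [0..<n]"

definition language_shift :: "real list set \<Rightarrow> (int \<Rightarrow> real) set" where
  "language_shift L = {\<omega>. \<forall>i n. window \<omega> i n \<in> L}"

lemma length_window [simp]: "length (window \<omega> i n) = n"
  by (simp add: window_def)

lemma nth_window: "j < n \<Longrightarrow> window \<omega> i n ! j = \<omega> (i + int j)"
  by (simp add: window_def)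

lemma window_eq_iff: "window \<omega> i n = window \<omega>' i' n \<longleftrightarrow> (\<forall>j<n. \<omega> (i + int j) = \<omega>' (i' + int j))"
  by (auto simp: list_eq_iff_nth_eq nth_window)

lemma window_translate: "window (\<lambda>n. \<omega> (n + k)) i n = window \<omega> (i + k) n"
  by (simp add: window_def algebra_simps)

lemma window_append: "window \<omega> i (m + n) = window \<omega> i m @ window \<omega> (i + int m) n"
  by (auto simp: list_eq_iff_nth_eq nth_window nth_append)

lemma sublist_window:
  assumes "i \<le> j" "j + int m \<le> i + int n"
  shows "sublist (window \<omega> j m) (window \<omega> i n)"
proof -
  define p where "p = nat (j - i)"
  define r where "r = n - p - m"
  have n: "n = p + (m + r)" and j: "j = i + int p" using assms by (auto simp: p_def r_def)
  show ?thesis unfolding n j window_append by blast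
qed

lemma sublist_windowE:
  assumes "sublist x (window \<omega> i n)"
  obtains j where "i \<le> j" "j + int (length x) \<le> i + int n" "window \<omega> j (length x) = x"
proof -
  from assms obtain ps ss where e: "window \<omega> i n = ps @ x @ ss" by (auto simp: sublist_def)
  then have n: "n = length ps + (length x + length ss)" by (metis length_append length_window)
  have "window \<omega> (i + int (length ps)) (length x) = x"
    using e unfolding n window_append by auto
  then show ?thesis using that[of "i + int (length ps)"] n by simp
qed

lemma compact_full_shift: "finite A \<Longrightarrow> compact (full_shift A)"
proof -
  assume "finite A"
  then have "compactin (product_topology (\<lambda>i::int. euclidean) UNIV) (PiE UNIV (\<lambda>_. A))"
    by (subst compactin_PiE) (auto intro: finite_imp_compact)
  moreover have "PiE UNIV (\<lambda>_. A) = full_shift A" by (auto simp: full_shift_def)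
  ultimately show ?thesis by (simp add: euclidean_product_topology)
qed

lemma closed_window_eq: "closed {\<omega> :: int \<Rightarrow> real. window \<omega> i n = x}"
proof (cases "length x = n")
  case True
  then have "{\<omega>. window \<omega> i n = x} = (\<Inter>j\<in>{..<n}. {\<omega>. \<omega> (i + int j) = x ! j})"
    by (auto simp: list_eq_iff_nth_eq nth_window)
  then show ?thesis by (auto intro!: closed_INT closed_Collect_eq)
next
  case False
  then have "{\<omega>. window \<omega> i n = x} = {}" by auto
  then show ?thesis by simp
qed

lemma closed_window_in:
  fixes A :: "real set"
  assumes "finite A" "L \<subseteq> lists A"
  shows "closed {\<omega>. window \<omega> i n \<in> L}"
proof -
  have "{\<omega>. window \<omega> i n \<in> L} = (\<Union>x\<in>{x\<in>L. length x = n}. {\<omega>. window \<omega> i n = x})" by auto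
  moreover have "finite {x\<in>L. length x = n}"
    by (rule finite_subset[OF _ finite_lists_length_eq[OF assms(1), of n]]) (use assms(2) in auto)
  ultimately show ?thesis by (simp add: closed_UN closed_window_eq)
qed

text \<open>Neighbourhoods in the product topology only constrain finitely many coordinates.\<close>

lemma in_closure_shift_orbit:
  assumes "\<And>m::nat. \<exists>k. \<forall>n. \<bar>n\<bar> \<le> int m \<longrightarrow> \<omega>' n = \<omega> (n + k)"
  shows "\<omega>' \<in> closure (shift_orbit \<omega>)"
proof -
  obtain k where k: "\<And>m n. \<bar>n\<bar> \<le> int m \<Longrightarrow> \<omega>' n = \<omega> (n + k m)" using assms by metis
  define f where "f m = (\<lambda>n. \<omega> (n + k m))" for m
  have "(\<lambda>m. f m n) \<longlonglongrightarrow> \<omega>' n" for n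
  proof (rule tendsto_eventually)
    show "\<forall>\<^sub>F m in sequentially. f m n = \<omega>' n"
      using eventually_ge_at_top[of "nat \<bar>n\<bar>"]
    proof eventually_elim
      case (elim m)
      then show ?case using k[of n m] by (simp add: f_def nat_le_iff)
    qed
  qed
  then have "limitin (product_topology (\<lambda>_. euclidean) UNIV) f \<omega>' sequentially"
    by (simp add: limitin_componentwise)
  then have "f \<longlonglongrightarrow> \<omega>'" by (simp add: euclidean_product_topology)
  moreover have "f m \<in> closure (shift_orbit \<omega>)" for m
    using closure_subset[of "shift_orbit \<omega>"] by (auto simp: shift_orbit_def f_def)
  ultimately show ?thesis using Lim_in_closed_set[of "closure (shift_orbit \<omega>)" f sequentially \<omega>'] by simp
qed

text \<open>A language closed under factors and with arbitrarily long words has a two-sided sequence by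
  compactness. Uniform recurrence makes every word of the language occur in every such sequence,
  which is minimality.\<close>

locale recurrent_language =
  fixes A :: "real set" and L :: "real list set"
  assumes finite_alphabet: "finite A"
    and over_alphabet: "L \<subseteq> lists A"
    and factorial: "x \<in> L \<Longrightarrow> sublist y x \<Longrightarrow> y \<in> L"
    and long_words: "\<exists>x\<in>L. n \<le> length x"
    and recurrent: "x \<in> L \<Longrightarrow> \<exists>R. \<forall>y\<in>L. R \<le> length y \<longrightarrow> sublist x y"
begin

lemma word_occurs:
  assumes "\<omega> \<in> language_shift L" "x \<in> L"
  obtains i where "window \<omega> i (length x) = x"
proof -
  obtain R where R: "\<And>y. y \<in> L \<Longrightarrow> R \<le> length y \<Longrightarrow> sublist x y" using recurrent[OF assms(2)] by blast
  have "sublist x (window \<omega> 0 R)" by (rule R) (use assms(1) in \<open>auto simp: language_shift_def\<close>)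
  then show ?thesis using that by (blast elim: sublist_windowE)
qed

lemma language_shift_subset: "language_shift L \<subseteq> full_shift A"
proof
  fix \<omega> assume "\<omega> \<in> language_shift L"
  then have "window \<omega> n 1 \<in> lists A" for n using over_alphabet by (auto simp: language_shift_def)
  then show "\<omega> \<in> full_shift A" by (simp add: window_def full_shift_def)
qed

lemma windows_occur:
  assumes "\<omega> \<in> language_shift L" "\<omega>' \<in> language_shift L"
  shows "\<exists>k. \<forall>n. \<bar>n\<bar> \<le> int m \<longrightarrow> \<omega>' n = \<omega> (n + k)"
proof -
  have "window \<omega>' (- int m) (2 * m + 1) \<in> L" using assms(2) by (auto simp: language_shift_def)
  then obtain i where i: "window \<omega> i (2 * m + 1) = window \<omega>' (- int m) (2 * m + 1)"
    using word_occurs[OF assms(1)] by (metis length_window)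
  have "\<omega>' n = \<omega> (n + (i + int m))" if "\<bar>n\<bar> \<le> int m" for n
  proof -
    have "\<forall>j<2 * m + 1. \<omega> (i + int j) = \<omega>' (- int m + int j)" using i unfolding window_eq_iff .
    moreover have "nat (n + int m) < 2 * m + 1" "int (nat (n + int m)) = n + int m" using that by auto
    ultimately have "\<omega> (i + (n + int m)) = \<omega>' (- int m + (n + int m))" by metis
    then show ?thesis by (simp add: algebra_simps)
  qed
  then show ?thesis by blast
qed

lemma language_shift_nonempty: "language_shift L \<noteq> {}"
proof -
  let ?C = "\<lambda>m. {\<omega>. window \<omega> (- int m) (2 * m + 1) \<in> L}"
  have "full_shift A \<inter> (\<Inter>m\<in>UNIV. ?C m) \<noteq> {}"
  proof (rule compact_imp_fip_image)
    show "compact (full_shift A)" by (rule compact_full_shift[OF finite_alphabet])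
    show "closed (?C m)" for m by (rule closed_window_in[OF finite_alphabet over_alphabet])
    fix I :: "nat set" assume "finite I"
    define M where "M = Max (insert 0 I)"
    obtain x where x: "x \<in> L" "2 * M + 1 \<le> length x" using long_words by blast
    define y where "y = take (2 * M + 1) x"
    have y: "y \<in> L" "length y = 2 * M + 1" using x factorial by (auto simp: y_def)
    then have yA: "set y \<subseteq> A" using over_alphabet by auto
    define \<omega> where "\<omega> n = (if \<bar>n\<bar> \<le> int M then y ! nat (n + int M) else y ! 0)" for n :: int
    have "\<omega> n \<in> set y" for n unfolding \<omega>_def using y(2) by (auto intro!: nth_mem)
    then have "\<omega> \<in> full_shift A" using yA by (auto simp: full_shift_def)
    moreover have "window \<omega> (- int M) (2 * M + 1) = y"
      using y(2) by (auto simp: list_eq_iff_nth_eq nth_window \<omega>_def)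
    then have "window \<omega> (- int m) (2 * m + 1) \<in> L" if "m \<in> I" for m
    proof -
      have "m \<le> M" using that \<open>finite I\<close> by (auto simp: M_def)
      then have "sublist (window \<omega> (- int m) (2 * m + 1)) (window \<omega> (- int M) (2 * M + 1))"
        by (intro sublist_window) auto
      then show ?thesis using \<open>window \<omega> (- int M) (2 * M + 1) = y\<close> factorial[OF y(1)] by metis
    qed
    ultimately show "full_shift A \<inter> (\<Inter>m\<in>I. ?C m) \<noteq> {}" by blast
  qed
  then obtain \<omega> where \<omega>: "\<And>m. window \<omega> (- int m) (2 * m + 1) \<in> L" by blast
  have "window \<omega> i n \<in> L" for i n
  proof (rule factorial[OF \<omega>[of "nat \<bar>i\<bar> + n"]])
    show "sublist (window \<omega> i n) (window \<omega> (- int (nat \<bar>i\<bar> + n)) (2 * (nat \<bar>i\<bar> + n) + 1))"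
      by (rule sublist_window) auto
  qed
  then show ?thesis by (auto simp: language_shift_def)
qed

lemma minimal_language_shift: "minimal_subshift A (language_shift L)"
proof -
  have "closed (language_shift L)"
  proof -
    have "language_shift L = (\<Inter>i. \<Inter>n. {\<omega>. window \<omega> i n \<in> L})" by (auto simp: language_shift_def)
    then show ?thesis using closed_window_in[OF finite_alphabet over_alphabet] by (auto intro!: closed_INT)
  qed
  then have "compact (language_shift L)"
    using compact_Int_closed[OF compact_full_shift[OF finite_alphabet]] language_shift_subset
    by (metis inf.absorb_iff2)
  moreover have "shift ` language_shift L = language_shift L"
  proof
    have inv: "(\<lambda>n. \<omega> (n + k)) \<in> language_shift L" if "\<omega> \<in> language_shift L" for \<omega> k
      using that by (auto simp: language_shift_def window_translate)
    then show "shift ` language_shift L \<subseteq> language_shift L" by (auto simp: shift_def)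
    show "language_shift L \<subseteq> shift ` language_shift L"
    proof
      fix \<omega> assume "\<omega> \<in> language_shift L"
      then show "\<omega> \<in> shift ` language_shift L"
        using inv[of \<omega> "-1"] by (intro image_eqI[of _ _ "\<lambda>n. \<omega> (n - 1)"]) (auto simp: shift_def)
    qed
  qed
  ultimately show ?thesis
    using language_shift_nonempty language_shift_subset windows_occur in_closure_shift_orbit
    by (auto simp: minimal_subshift_def subshift_def)
qed

end

section \<open>Hierarchies of block concatenations\<close>

abbreviation word_power :: "nat \<Rightarrow> 'a list \<Rightarrow> 'a list" where
  "word_power m w \<equiv> concat (replicate m w)"

lemma length_word_power: "length (word_power m w) = m * length w"
  by (induction m) auto

lemma nth_word_power: "j < m * length w \<Longrightarrow> word_power m w ! j = w ! (j mod length w)"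
proof (induction m arbitrary: j)
  case (Suc m)
  then show ?case by (cases "j < length w") (auto simp: nth_append le_mod_geq)
qed simp

lemma sublist_concat: "w \<in> set ws \<Longrightarrow> sublist w (concat ws)"
  by (metis concat.simps(2) concat_append in_set_conv_decomp sublist_appendI)

text \<open>A factor of a concatenation that is twice as long as all blocks starts inside some block, and
  after the rest of that block it still covers the whole next block.\<close>

lemma long_factor_contains_block:
  assumes "\<And>v. v \<in> set ws \<Longrightarrow> length v \<le> l" "sublist y (concat ws)" "2 * l \<le> length y" "0 < l"
  shows "\<exists>v\<in>set ws. sublist v y"
  using assms
proof (induction ws)
  case Nil
  then show ?case by simp
next
  case (Cons v ws)
  from Cons.prems(2) obtain ps ss where e: "v @ concat ws = ps @ y @ ss" by (auto simp: sublist_def)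
  have v: "length v \<le> l" using Cons.prems(1) by simp
  consider us where "ps = v @ us" "concat ws = us @ y @ ss"
    | us where "v = ps @ us" "us @ concat ws = y @ ss"
    using e by (auto simp: append_eq_append_conv2)
  then show ?case
  proof cases
    case 1
    then show ?thesis using Cons by auto
  next
    case (2 us)
    have us: "length us \<le> l" using 2(1) v by simp
    then have "length us \<le> length y" using Cons.prems(3) by simp
    then obtain y' where y': "y = us @ y'" "concat ws = y' @ ss"
      using 2(2) by (auto simp: append_eq_append_conv2)
    have ly': "l \<le> length y'" using y' us Cons.prems(3) by simp
    then obtain v' ws' where ws: "ws = v' # ws'" using y'(2) Cons.prems(4) by (cases ws) auto
    have "length v' \<le> length y'" using Cons.prems(1)[of v'] ws ly' by simp
    then obtain zs where "y' = v' @ zs" using y'(2) ws by (auto simp: append_eq_append_conv2)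
    then show ?thesis using ws y'(1) by auto
  qed
qed

lemma concat_concat_lists:
  assumes "\<forall>v\<in>set vs. \<exists>ws\<in>lists V. v = concat ws"
  shows "\<exists>ws\<in>lists V. concat vs = concat ws"
  using assms
proof (induction vs)
  case Nil
  then show ?case by (intro bexI[of _ "[]"]) auto
next
  case (Cons v vs)
  then obtain ws1 ws2 where "ws1 \<in> lists V" "v = concat ws1" "ws2 \<in> lists V" "concat vs = concat ws2"
    by auto
  then show ?case by (intro bexI[of _ "ws1 @ ws2"]) auto
qed

subsection \<open>Periods of sequences\<close>

definition period :: "(int \<Rightarrow> 'a) \<Rightarrow> int \<Rightarrow> bool" where
  "period \<omega> p \<longleftrightarrow> (\<forall>n. \<omega> (n + p) = \<omega> n)"

lemma period_diff: "period \<omega> p \<Longrightarrow> period \<omega> q \<Longrightarrow> period \<omega> (p - q)"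
  unfolding period_def by (metis add.commute add_diff_eq diff_add_cancel)

lemma period_mult: "period \<omega> p \<Longrightarrow> period \<omega> (p * q)"
proof (induction q rule: int_induct[where k=0])
  case base
  then show ?case by (simp add: period_def)
next
  case (step1 i)
  then have "period \<omega> (p * i - (0 - p))" by (intro period_diff) (auto simp: period_def)
  then show ?case by (simp add: algebra_simps)
next
  case (step2 i)
  then have "period \<omega> (p * i - p)" by (intro period_diff) auto
  then show ?case by (simp add: algebra_simps)
qed

text \<open>Since \<open>\<omega>\<close> is determined by any \<open>p\<close> consecutive entries, agreement with its translate by
  \<open>length w\<close> on \<open>p\<close> consecutive positions is agreement everywhere.\<close>

lemma period_of_word_power:
  assumes p: "0 < p" "period \<omega> p" and w: "window \<omega> i (m * length w) = word_power m w"
    and m: "p + int (length w) \<le> int (m * length w)"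
  shows "period \<omega> (int (length w))"
  unfolding period_def
proof
  fix n
  define j where "j = nat ((n - i) mod p)"
  have j: "int j = (n - i) mod p" "int j < p" using p(1) by (auto simp: j_def)
  have lt: "j + length w < m * length w" using j(2) m by linarith
  have n: "n = i + int j + p * ((n - i) div p)"
    unfolding j(1) using mult_div_mod_eq[of p "n - i"] by linarith
  have per: "\<omega> (k + p * ((n - i) div p)) = \<omega> k" for k
    using period_mult[OF p(2)] by (auto simp: period_def)
  have "\<omega> (n + int (length w)) = \<omega> (i + int (j + length w))"
    using per[of "i + int (j + length w)"] by (subst n) (simp add: algebra_simps)
  also have "\<dots> = w ! ((j + length w) mod length w)"
    using w nth_window[OF lt, of \<omega> i] nth_word_power[OF lt] by simp
  also have "\<dots> = w ! (j mod length w)" by simp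
  also have "\<dots> = \<omega> (i + int j)"
    using w nth_window[of j "m * length w" \<omega> i] nth_word_power[of j m w] lt by simp
  also have "\<dots> = \<omega> n" using per[of "i + int j"] n by simp
  finally show "\<omega> (n + int (length w)) = \<omega> n" .
qed

subsection \<open>The subshift of a block hierarchy\<close>

text \<open>The blocks of the next level consist of many repetitions of one block \<open>w\<close> followed by the
  concatenation of all blocks. The repetitions will keep the spectrum of the periodic sequence with
  period \<open>w\<close> visible, the final part makes the language recurrent, and at least two admissible
  exponents rule out periodicity.\<close>

locale block_hierarchy =
  fixes a b :: real and W :: "nat \<Rightarrow> real list list" and N :: "nat \<Rightarrow> nat"
  assumes distinct_letters: "a \<noteq> b"
    and W_0: "W 0 = [[a], [b]]"
    and set_W_Suc: "set (W (Suc k)) = (\<lambda>(m, w). word_power m w @ concat (W k)) ` ({k + 2..N k} \<times> set (W k))"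
    and N_ge: "k + 3 \<le> N k"
begin

definition L :: "real list set" where
  "L = {x. \<exists>k. sublist x (concat (W k))}"

lemma W_nonempty: "W k \<noteq> []"
proof (induction k)
  case (Suc k)
  then have "set (W (Suc k)) \<noteq> {}" unfolding set_W_Suc using N_ge[of k] by auto
  then show ?case by auto
qed (simp add: W_0)

lemma block_nonempty: "w \<in> set (W k) \<Longrightarrow> w \<noteq> []"
proof (induction k arbitrary: w)
  case (Suc k)
  from Suc.prems obtain m v where "w = word_power m v @ concat (W k)" "v \<in> set (W k)"
    unfolding set_W_Suc by auto
  then show ?case using Suc.IH[of v] by auto
qed (auto simp: W_0)

lemma letters: "w \<in> set (W k) \<Longrightarrow> set w \<subseteq> {a, b}"
proof (induction k arbitrary: w)
  case (Suc k)
  then show ?case unfolding set_W_Suc by (auto simp: subset_iff) blast+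
qed (auto simp: W_0)

lemma sublist_block_Suc: "w \<in> set (W (Suc k)) \<Longrightarrow> sublist (concat (W k)) w"
  unfolding set_W_Suc by auto

lemma sublist_concat_mono:
  assumes "j \<le> k" shows "sublist (concat (W j)) (concat (W k))"
  using assms
proof (induction k rule: dec_induct)
  case (step n)
  obtain w where "w \<in> set (W (Suc n))" using W_nonempty[of "Suc n"] by (meson last_in_set)
  then show ?case
    using sublist_block_Suc sublist_concat step.IH by (metis sublist_order.order.trans)
qed simp

lemma block_decomposes:
  assumes "j \<le> k" "w \<in> set (W k)"
  shows "\<exists>ws\<in>lists (set (W j)). w = concat ws"
  using assms
proof (induction k arbitrary: w rule: dec_induct)
  case base
  then show ?case by (intro bexI[of _ "[w]"]) auto
next
  case (step n)
  from step.prems obtain m v where w: "w = word_power m v @ concat (W n)" "v \<in> set (W n)"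
    unfolding set_W_Suc by auto
  have "\<exists>ws\<in>lists (set (W j)). concat (replicate m v @ W n) = concat ws"
    by (rule concat_concat_lists) (use step.IH w(2) in auto)
  then show ?case using w(1) by simp
qed

lemma word_power_in_L:
  assumes "w \<in> set (W k)" shows "word_power (k + 2) w \<in> L"
proof -
  have "word_power (k + 2) w @ concat (W k) \<in> set (W (Suc k))"
    unfolding set_W_Suc using assms N_ge[of k] by force
  then have "sublist (word_power (k + 2) w) (concat (W (Suc k)))"
    by (metis sublist_concat sublist_append_rightI sublist_order.order.trans)
  then show ?thesis unfolding L_def by blast
qed

lemma length_concat_ge: "k \<le> length (concat (W k))"
proof (induction k)
  case (Suc k)
  obtain w where w: "w \<in> set (W k)" using W_nonempty[of k] by (meson last_in_set)
  let ?v = "word_power (k + 2) w @ concat (W k)"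
  have "?v \<in> set (W (Suc k))" unfolding set_W_Suc using w N_ge[of k] by force
  then have "length ?v \<le> length (concat (W (Suc k)))" by (intro sublist_length_le sublist_concat)
  moreover have "length w > 0" using block_nonempty[OF w] by simp
  moreover have "length ?v = length w + (k + 1) * length w + length (concat (W k))"
    unfolding length_append length_word_power by (simp add: algebra_simps)
  ultimately show ?case using Suc by linarith
qed simp

lemma recurrent_L:
  assumes "x \<in> L" shows "\<exists>R. \<forall>y\<in>L. R \<le> length y \<longrightarrow> sublist x y"
proof -
  obtain k where k: "sublist x (concat (W k))" using assms by (auto simp: L_def)
  define l where "l = Suc (Max (length ` set (W (Suc k))))"
  have l: "length v \<le> l" if "v \<in> set (W (Suc k))" for v
    using that by (auto simp: l_def intro!: le_SucI Max_ge)
  have "sublist x y" if "y \<in> L" "2 * l \<le> length y" for y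
  proof -
    from that(1) obtain j where j: "sublist y (concat (W j))" by (auto simp: L_def)
    define i where "i = max j (Suc k)"
    have i: "sublist y (concat (W i))"
      using j sublist_concat_mono[of j i] unfolding i_def by (metis max.cobounded1 sublist_order.order.trans)
    have "\<exists>ws\<in>lists (set (W (Suc k))). concat (W i) = concat ws"
      by (rule concat_concat_lists) (use block_decomposes[of "Suc k" i] in \<open>auto simp: i_def\<close>)
    then obtain ws where ws: "ws \<in> lists (set (W (Suc k)))" "concat (W i) = concat ws" by blast
    have "\<exists>v\<in>set ws. sublist v y"
      by (rule long_factor_contains_block[where l = l])
        (use ws i that(2) l in \<open>auto simp: l_def in_lists_conv_set\<close>)
    then obtain v where v: "v \<in> set (W (Suc k))" "sublist v y" using ws(1) by auto
    then show ?thesis using k sublist_block_Suc[OF v(1)] by (meson sublist_order.order.trans)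
  qed
  then show ?thesis by blast
qed

sublocale recurrent_language "{a, b}" L
proof
  show "finite {a, b}" by simp
  show "L \<subseteq> lists {a, b}"
  proof
    fix x assume "x \<in> L"
    then obtain k where "sublist x (concat (W k))" by (auto simp: L_def)
    then have "set x \<subseteq> (\<Union>w\<in>set (W k). set w)" using set_mono_sublist by fastforce
    then show "x \<in> lists {a, b}" using letters[of _ k] by blast
  qed
  show "y \<in> L" if "x \<in> L" "sublist y x" for x y
    using that unfolding L_def by (blast intro: sublist_order.order.trans)
  show "\<exists>x\<in>L. n \<le> length x" for n
    by (rule bexI[of _ "concat (W n)"]) (auto simp: L_def length_concat_ge)
  show "\<exists>R. \<forall>y\<in>L. R \<le> length y \<longrightarrow> sublist x y" if "x \<in> L" for x
    by (rule recurrent_L[OF that])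
qed

text \<open>If \<open>\<omega>\<close> had period \<open>p\<close>, then long powers of a block \<open>w\<close> of a high level would make
  \<open>length w\<close> a period. Blocks \<open>w\<^sup>m u\<close> and \<open>w\<^sup>m\<^sup>+\<^sup>1 u\<close> of one level give periods that differ by
  \<open>length w\<close>, so this property descends to level \<open>0\<close>, where it says that \<open>\<omega>\<close> is constant.\<close>

lemma not_periodic_language_shift: "not_periodic (language_shift L)"
  unfolding not_periodic_def
proof (intro ballI notI)
  fix \<omega> assume \<omega>: "\<omega> \<in> language_shift L" and "periodic_seq \<omega>"
  then obtain p where p: "0 < p" "period \<omega> p" by (auto simp: periodic_seq_def period_def)
  have "\<forall>w\<in>set (W k). period \<omega> (int (length w))" if "k \<le> nat p" for k
    using that
  proof (induction k rule: inc_induct)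
    case base
    show ?case
    proof
      fix w assume w: "w \<in> set (W (nat p))"
      obtain i where i: "window \<omega> i (length (word_power (nat p + 2) w)) = word_power (nat p + 2) w"
        using word_occurs[OF \<omega> word_power_in_L[OF w]] by blast
      have "int (length w) \<ge> 1" using block_nonempty[OF w] by (cases w) auto
      then have "p * 1 \<le> p * int (length w)" using p(1) by (intro mult_left_mono) auto
      moreover have "int ((nat p + 2) * length w) = p * int (length w) + 2 * int (length w)"
        using p(1) by (simp add: distrib_right)
      ultimately have "p + int (length w) \<le> int ((nat p + 2) * length w)" by linarith
      then show "period \<omega> (int (length w))"
        using period_of_word_power[OF p] i unfolding length_word_power by blast
    qed
  next
    case (step k)
    show ?case
    proof
      fix w assume w: "w \<in> set (W k)"
      have block: "word_power m w @ concat (W k) \<in> set (W (Suc k))" if "m \<in> {k + 2..N k}" for m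
        unfolding set_W_Suc using that w by force
      have "word_power (k + 3) w @ concat (W k) \<in> set (W (Suc k))"
        by (rule block) (use N_ge[of k] in simp)
      moreover have "word_power (k + 2) w @ concat (W k) \<in> set (W (Suc k))"
        by (rule block) (use N_ge[of k] in simp)
      ultimately have "period \<omega> (int (length (word_power (k + 3) w @ concat (W k))))"
        "period \<omega> (int (length (word_power (k + 2) w @ concat (W k))))"
        using step.IH by blast+
      from period_diff[OF this] show "period \<omega> (int (length w))"
        unfolding length_append length_word_power by (simp add: algebra_simps)
    qed
  qed
  from this[of 0] have per: "\<omega> (n + 1) = \<omega> n" for n by (simp add: W_0 period_def)
  have "[a, b] \<in> L" unfolding L_def using W_0 by (auto intro!: exI[of _ 0])
  then obtain i where "window \<omega> i (length [a, b]) = [a, b]" using word_occurs[OF \<omega>] by blast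
  then have "\<omega> i = a" "\<omega> (i + 1) = b" by (auto simp: window_def upt_conv_Cons)
  then show False using per distinct_letters by simp
qed

end

section \<open>Transfer matrices and bands\<close>

text \<open>A real two by two matrix is the tuple of its entries, row by row.\<close>

type_synonym mat2 = "real \<times> real \<times> real \<times> real"

fun mat_mul :: "mat2 \<Rightarrow> mat2 \<Rightarrow> mat2" where
  "mat_mul (a, b, c, d) (a', b', c', d') = (a * a' + b * c', a * b' + b * d', c * a' + d * c', c * b' + d * d')"

fun mat_trace :: "mat2 \<Rightarrow> real" where "mat_trace (a, b, c, d) = a + d"

fun mat_det :: "mat2 \<Rightarrow> real" where "mat_det (a, b, c, d) = a * d - b * c"

fun transfer :: "real \<Rightarrow> real list \<Rightarrow> mat2" where
  "transfer E [] = (1, 0, 0, 1)"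
| "transfer E (v # w) = mat_mul (transfer E w) (E - v, -1, 1, 0)"

text \<open>For nonempty \<open>w\<close>, this is the spectrum of the \<open>w\<close>-periodic potential up to finitely many points,
  the energies where the trace is \<open>2\<close> or \<open>-2\<close>.\<close>

definition band :: "real list \<Rightarrow> real set" where
  "band w = {E. \<bar>mat_trace (transfer E w)\<bar> < 2}"

lemma mat_mul_assoc: "mat_mul (mat_mul M M') M'' = mat_mul M (mat_mul M' M'')"
  by (cases M; cases M'; cases M'') (simp add: algebra_simps)

lemma transfer_append: "transfer E (u @ v) = mat_mul (transfer E v) (transfer E u)"
proof (induction u)
  case Nil
  then show ?case by (cases "transfer E v") simp
qed (simp add: mat_mul_assoc)

lemma det_transfer: "mat_det (transfer E w) = 1"
proof (induction w)
  case (Cons v w)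
  then show ?case by (cases "transfer E w") (simp add: algebra_simps)
qed simp

text \<open>The Cayley-Hamilton theorem for matrices of determinant \<open>1\<close>, inside a trace.\<close>

lemma trace_Cayley_Hamilton:
  assumes "mat_det M = 1"
  shows "mat_trace (mat_mul X (mat_mul M M)) = mat_trace M * mat_trace (mat_mul X M) - mat_trace X"
proof -
  obtain a b c d a' b' c' d' where M: "M = (a, b, c, d)" and X: "X = (a', b', c', d')"
    by (metis prod_cases4)
  have "a * d - b * c = 1" using assms by (simp add: M)
  then have "a' * (a * d - b * c) + d' * (a * d - b * c) = a' + d'" by simp
  then show ?thesis by (simp add: M X algebra_simps)
qed

lemma transfer_entries_poly:
  assumes "w \<noteq> []"
  shows "\<exists>p q r s :: real poly. (\<forall>E. transfer E w = (poly p E, poly q E, poly r E, poly s E))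
    \<and> degree p = length w \<and> degree q < length w \<and> degree r < length w \<and> degree s < length w"
  using assms
proof (induction w rule: list_nonempty_induct)
  case (single v)
  show ?case
    by (intro exI[of _ "[:- v, 1:]"] exI[of _ "[:-1:]"] exI[of _ "[:1:]"] exI[of _ 0]) auto
next
  case (cons v w)
  then obtain p q r s :: "real poly" where
    e: "\<And>E. transfer E w = (poly p E, poly q E, poly r E, poly s E)"
    and d: "degree p = length w" "degree q < length w" "degree r < length w" "degree s < length w"
    by blast
  let ?x = "[:- v, 1:]"
  have "p \<noteq> 0" using d cons.hyps by auto
  then have "degree (?x * p) = Suc (length w)" by (subst degree_mult_eq) (auto simp: d)
  then have "degree (?x * p + q) = Suc (length w)" using d(2) by (subst degree_add_eq_left) auto
  moreover have "degree (?x * r + s) < Suc (length w)"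
    using degree_mult_le[of ?x r] d degree_add_le_max[of "?x * r" s] by simp
  moreover have "transfer E (v # w) = (poly (?x * p + q) E, poly (- p) E, poly (?x * r + s) E, poly (- r) E)" for E
    by (simp add: e algebra_simps)
  ultimately show ?case using d
    by (intro exI[of _ "?x * p + q"] exI[of _ "- p"] exI[of _ "?x * r + s"] exI[of _ "- r"]) auto
qed

lemma trace_transfer_poly:
  assumes "w \<noteq> []"
  obtains t :: "real poly" where "degree t = length w" "\<And>E. mat_trace (transfer E w) = poly t E"
proof -
  obtain p q r s :: "real poly" where
    e: "\<And>E. transfer E w = (poly p E, poly q E, poly r E, poly s E)"
    and d: "degree p = length w" "degree s < length w"
    using transfer_entries_poly[OF assms] by blast
  show ?thesis
    by (rule that[of "p + s"]) (use d e in \<open>auto simp: degree_add_eq_left\<close>)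
qed

lemma open_band: "open (band w)"
proof (cases "w = []")
  case True
  then show ?thesis by (simp add: band_def)
next
  case False
  then obtain t where t: "\<And>E. mat_trace (transfer E w) = poly t E" by (metis trace_transfer_poly)
  show ?thesis unfolding band_def t
    by (intro open_Collect_less continuous_intros)
qed

lemma finite_trace_level:
  assumes "w \<noteq> []" shows "finite {E. mat_trace (transfer E w) = y}"
proof -
  obtain t where t: "degree t = length w" "\<And>E. mat_trace (transfer E w) = poly t E"
    using trace_transfer_poly[OF assms] by blast
  have "t - [:y:] \<noteq> 0" using t(1) assms by (metis degree_pCons_0 eq_iff_diff_eq_0 length_0_conv)
  then have "finite {E. poly (t - [:y:]) E = 0}" by (rule poly_roots_finite)
  then show ?thesis by (simp add: t(2))
qed

subsection \<open>Defects disappear in the union over the exponents\<close>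

text \<open>On the band of \<open>w\<close> the matrix of \<open>w\<close> is conjugate to a rotation by an angle \<open>\<theta>\<close>, so the trace for
  \<open>w\<^sup>m u\<close> oscillates like \<open>r cos (m \<theta> - \<phi>)\<close>.\<close>

lemma second_order_recurrence_cos:
  fixes t :: "nat \<Rightarrow> real"
  assumes "sin \<theta> \<noteq> 0" and rec: "\<And>m. t (m + 2) = 2 * cos \<theta> * t (m + 1) - t m"
  obtains r \<phi> where "\<And>m. t m = r * cos (real m * \<theta> - \<phi>)"
proof -
  define D where "D = (t 1 - t 0 * cos \<theta>) / sin \<theta>"
  have t: "t m = t 0 * cos (real m * \<theta>) + D * sin (real m * \<theta>)
      \<and> t (m + 1) = t 0 * cos (real (m + 1) * \<theta>) + D * sin (real (m + 1) * \<theta>)" for m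
  proof (induction m)
    case 0
    then show ?case using assms(1) by (simp add: D_def)
  next
    case (Suc m)
    have 2: "f (real (m + 2) * \<theta>) = 2 * cos \<theta> * f (real (m + 1) * \<theta>) - f (real m * \<theta>)"
      if "f = cos \<or> f = sin" for f :: "real \<Rightarrow> real"
    proof -
      have a: "real (m + 2) * \<theta> = real (m + 1) * \<theta> + \<theta>" "real m * \<theta> = real (m + 1) * \<theta> - \<theta>"
        by (simp_all add: algebra_simps)
      show ?thesis unfolding a using that
        by (auto simp: cos_add cos_diff sin_add sin_diff)
    qed
    have "t (m + 2) = t 0 * cos (real (m + 2) * \<theta>) + D * sin (real (m + 2) * \<theta>)"
      unfolding rec[of m] using Suc by (simp only: 2 simp_thms) (simp add: algebra_simps)
    then show ?case using Suc by simp
  qed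
  obtain r \<phi> where "t 0 = r * cos \<phi>" "D = r * sin \<phi>" using polar_Ex by blast
  then have "t m = r * cos (real m * \<theta> - \<phi>)" for m
    using t[of m] by (simp add: cos_diff algebra_simps)
  then show ?thesis by (rule that)
qed

text \<open>For an irrational rotation, the phase \<open>m \<theta> - \<phi>\<close> comes close to \<open>\<pi>/2\<close> modulo \<open>2\<pi>\<close> for
  arbitrarily large \<open>m\<close>, so the cosine compensates for the amplitude \<open>r\<close>, however large that is.\<close>

lemma irrational_rotation_small_cos:
  assumes "\<theta> / (2 * pi) \<notin> \<rat>"
  obtains m where "n \<le> m" "\<bar>r * cos (real m * \<theta> - \<phi>)\<bar> < 2"
proof -
  define \<alpha> where "\<alpha> = \<theta> / (2 * pi)"
  define \<beta> where "\<beta> = (\<phi> + pi / 2) / (2 * pi) - real n * \<alpha>"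
  define \<epsilon> where "\<epsilon> = 1 / (2 * pi * (\<bar>r\<bar> + 1))"
  have \<epsilon>: "\<epsilon> > 0" by (simp add: \<epsilon>_def)
  obtain k where k: "\<bar>frac (real k * \<alpha>) - frac \<beta>\<bar> < \<epsilon>"
    using Kronecker_approx_1_explicit[of \<alpha> "frac \<beta>" \<epsilon>] assms \<epsilon>
    by (metis \<alpha>_def frac_ge_0 frac_lt_1 less_imp_le)
  define \<delta> where "\<delta> = frac (real k * \<alpha>) - frac \<beta>"
  define j where "j = \<lfloor>real k * \<alpha>\<rfloor> - \<lfloor>\<beta>\<rfloor>"
  have "real k * \<alpha> - \<beta> = \<delta> + of_int j" by (simp add: \<delta>_def j_def frac_def)
  then have "real (n + k) * \<alpha> = (\<phi> + pi / 2) / (2 * pi) + \<delta> + of_int j"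
    by (simp add: \<beta>_def algebra_simps)
  then have "2 * pi * (real (n + k) * \<alpha>) = 2 * pi * ((\<phi> + pi / 2) / (2 * pi)) + 2 * pi * \<delta> + of_int j * (2 * pi)"
    by (simp only: distrib_left mult.commute)
  moreover have "2 * pi * (real (n + k) * \<alpha>) = real (n + k) * \<theta>" by (simp add: \<alpha>_def)
  moreover have "2 * pi * ((\<phi> + pi / 2) / (2 * pi)) = \<phi> + pi / 2" by simp
  ultimately have "real (n + k) * \<theta> - \<phi> = (pi / 2 + 2 * pi * \<delta>) + of_int j * (2 * pi)" by linarith
  then have "cos (real (n + k) * \<theta> - \<phi>) = cos (pi / 2 + 2 * pi * \<delta>)"
    using cos.plus_of_int[of "pi / 2 + 2 * pi * \<delta>" j] by simp
  also have "\<dots> = - sin (2 * pi * \<delta>)" by (simp add: cos_add)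
  finally have "\<bar>r * cos (real (n + k) * \<theta> - \<phi>)\<bar> = \<bar>r\<bar> * \<bar>sin (2 * pi * \<delta>)\<bar>" by (simp add: abs_mult)
  also have "\<dots> \<le> \<bar>r\<bar> * (2 * pi * \<bar>\<delta>\<bar>)"
    using abs_sin_x_le_abs_x[of "2 * pi * \<delta>"] by (intro mult_left_mono) (auto simp: abs_mult)
  also have "\<dots> \<le> \<bar>r\<bar> * (2 * pi * \<epsilon>)" using k by (intro mult_left_mono) (auto simp: \<delta>_def)
  also have "\<dots> = \<bar>r\<bar> / (\<bar>r\<bar> + 1)" by (simp add: \<epsilon>_def)
  also have "\<dots> < 2" by (simp add: field_simps)
  finally show ?thesis using that[of "n + k"] by simp
qed

text \<open>The angle is a rational multiple of \<open>\<pi>\<close> only for countably many energies, because the trace is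
  a polynomial of positive degree.\<close>

lemma countable_band_minus_defects:
  assumes "w \<noteq> []"
  shows "countable (band w - (\<Union>m\<in>{n..}. band (word_power m w @ u)))"
proof -
  define X where "X = (\<Union>q\<in>\<rat>. {E. mat_trace (transfer E w) = 2 * cos (2 * pi * q)})"
  have "countable X" unfolding X_def
    by (intro countable_UN countable_rat countable_finite finite_trace_level assms)
  moreover have "\<exists>m\<ge>n. E \<in> band (word_power m w @ u)" if E: "E \<in> band w" "E \<notin> X" for E
  proof -
    define M where "M = transfer E w"
    define \<theta> where "\<theta> = arccos (mat_trace M / 2)"
    have b: "-1 < mat_trace M / 2" "mat_trace M / 2 < 1" using E(1) by (auto simp: band_def M_def)
    then have cos: "cos \<theta> = mat_trace M / 2" by (simp add: \<theta>_def)
    have "\<theta> / (2 * pi) \<notin> \<rat>"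
    proof
      assume "\<theta> / (2 * pi) \<in> \<rat>"
      moreover have "mat_trace (transfer E w) = 2 * cos (2 * pi * (\<theta> / (2 * pi)))"
        using cos by (simp add: M_def)
      ultimately show False using E(2) unfolding X_def by blast
    qed
    define t where "t m = mat_trace (transfer E (word_power m w @ u))" for m
    have rec: "t (m + 2) = 2 * cos \<theta> * t (m + 1) - t m" for m
      using trace_Cayley_Hamilton[OF det_transfer, of "transfer E (word_power m w @ u)" E w]
      by (simp add: t_def cos M_def transfer_append mat_mul_assoc)
    have "sin \<theta> \<noteq> 0" using b by (simp add: \<theta>_def sin_arccos_nonzero)
    then obtain r \<phi> where t: "\<And>m. t m = r * cos (real m * \<theta> - \<phi>)"
      using second_order_recurrence_cos[of \<theta> t] rec by blast
    obtain m where "n \<le> m" "\<bar>t m\<bar> < 2"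
      using irrational_rotation_small_cos[OF \<open>\<theta> / (2 * pi) \<notin> \<rat>\<close>, of n r \<phi>] t by metis
    then show ?thesis by (auto simp: band_def t_def)
  qed
  then have "band w - (\<Union>m\<in>{n..}. band (word_power m w @ u)) \<subseteq> X" by auto
  ultimately show ?thesis using countable_subset by blast
qed

text \<open>Continuity of measure from above turns this into a finite range of exponents.\<close>

lemma finitely_many_exponents_suffice:
  assumes "finite V" "[] \<notin> V" "0 < \<epsilon>"
  obtains n where "l \<le> n"
    "emeasure lborel ({c<..<d} \<inter> (\<Union>w\<in>V. band w)
        - (\<Union>w\<in>V. \<Union>m\<in>{k..n}. band (word_power m w @ u))) < (\<epsilon>::ennreal)"
proof -
  define G where "G = {c<..<d} \<inter> (\<Union>w\<in>V. band w)"
  define B where "B n = G - (\<Union>w\<in>V. \<Union>m\<in>{k..n}. band (word_power m w @ u))" for n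
  have "open G" unfolding G_def by (auto intro!: open_Int open_UN open_band)
  then have sets: "B n \<in> sets lborel" for n
    unfolding B_def sets_lborel by (intro sets.Diff borel_open open_UN ballI open_band)
  have fin: "emeasure lborel (B n) \<noteq> \<infinity>" for n
  proof -
    have "emeasure lborel (B n) \<le> emeasure lborel {c..d}"
      by (rule emeasure_mono) (auto simp: B_def G_def)
    then show ?thesis using emeasure_compact_finite[of "{c..d}"] by (auto simp: top_unique)
  qed
  have "decseq B" unfolding decseq_def B_def by fastforce
  then have "(\<lambda>n. emeasure lborel (B n)) \<longlonglongrightarrow> emeasure lborel (\<Inter>n. B n)"
    using sets fin by (intro Lim_emeasure_decseq) auto
  moreover have "countable (\<Inter>n. B n)"
  proof (rule countable_subset)
    show "(\<Inter>n. B n) \<subseteq> (\<Union>w\<in>V. band w - (\<Union>m\<in>{k..}. band (word_power m w @ u)))"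
      unfolding B_def G_def by fastforce
    show "countable (\<Union>w\<in>V. band w - (\<Union>m\<in>{k..}. band (word_power m w @ u)))"
      using assms(1,2) by (intro countable_UN countable_finite countable_band_minus_defects) auto
  qed
  then have "emeasure lborel (\<Inter>n. B n) = 0" by (rule emeasure_lborel_countable)
  ultimately have "\<forall>\<^sub>F n in sequentially. emeasure lborel (B n) < \<epsilon>"
    using assms(3) order_tendstoD(2) by metis
  then have "\<forall>\<^sub>F n in sequentially. emeasure lborel (B n) < \<epsilon> \<and> l \<le> n"
    using eventually_ge_at_top[of l] by eventually_elim auto
  from eventually_happens[OF this] obtain n where n: "emeasure lborel (B n) < \<epsilon>" "l \<le> n" by auto
  show ?thesis using that[OF n(2)] n(1) unfolding B_def G_def by blast
qed

subsection \<open>Bloch solutions give approximate eigenvectors\<close>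

lemma transfer_solution:
  fixes x :: "nat \<Rightarrow> complex"
  assumes "\<And>j. j < length w \<Longrightarrow>
      x (k + j + 2) = complex_of_real (E - w ! j) * x (k + j + 1) - x (k + j)"
    and "transfer E w = (a, b, c, d)"
  shows "x (k + length w + 1) = a * x (k + 1) + b * x k
       \<and> x (k + length w) = c * x (k + 1) + d * x k"
  using assms
proof (induction w arbitrary: k a b c d)
  case (Cons v w)
  obtain a' b' c' d' where T: "transfer E w = (a', b', c', d')" by (metis prod_cases4)
  have IH: "x (Suc k + length w + 1) = a' * x (Suc k + 1) + b' * x (Suc k)
       \<and> x (Suc k + length w) = c' * x (Suc k + 1) + d' * x (Suc k)"
  proof (rule Cons.IH[OF _ T])
    fix j assume "j < length w"
    then show "x (Suc k + j + 2) = complex_of_real (E - w ! j) * x (Suc k + j + 1) - x (Suc k + j)"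
      using Cons.prems(1)[of "Suc j"] by simp
  qed
  have xk: "x k = complex_of_real (E - v) * x (k + 1) - x (k + 2)" using Cons.prems(1)[of 0] by simp
  have abcd: "a = a' * (E - v) + b'" "b = - a'" "c = c' * (E - v) + d'" "d = - c'"
    using Cons.prems(2) T by auto
  show ?case using IH unfolding abcd xk by (simp add: algebra_simps)
qed simp

lemma Bloch_solution:
  assumes "E \<in> band w" "w \<noteq> []"
  obtains x :: "nat \<Rightarrow> complex" where
    "\<And>n. x (n + 2) = complex_of_real (E - w ! (n mod length w)) * x (n + 1) - x n"
    "\<And>n. cmod (x (n + length w)) = cmod (x n)" "x 1 \<noteq> 0"
proof -
  obtain a b c d where M: "transfer E w = (a, b, c, d)" by (metis prod_cases4)
  have det: "a * d - b * c = 1" using det_transfer[of E w] M by simp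
  have tr: "\<bar>a + d\<bar> < 2" using assms(1) M by (simp add: band_def)
  then have tr2: "(a + d)\<^sup>2 < 4" using abs_square_less_1[of "(a + d) / 2"] by (simp add: power_divide)
  \<comment> \<open>a triangular matrix of determinant \<open>1\<close> would have trace at least \<open>2\<close> in modulus\<close>
  have b: "b \<noteq> 0"
  proof
    assume "b = 0"
    then have "(a + d)\<^sup>2 = (a - d)\<^sup>2 + 4" using det by (simp add: power2_eq_square algebra_simps)
    then show False using tr2 by simp
  qed
  define \<mu> where "\<mu> = Complex ((a + d) / 2) (sqrt (1 - ((a + d) / 2)\<^sup>2))"
  have sq: "(sqrt (1 - ((a + d) / 2)\<^sup>2))\<^sup>2 = 1 - ((a + d) / 2)\<^sup>2" using tr2 by (simp add: power_divide)
  then have \<mu>1: "cmod \<mu> = 1" by (simp add: \<mu>_def cmod_def)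
  have \<mu>2: "\<mu> * \<mu> - (a + d) * \<mu> + 1 = 0"
  proof -
    let ?r = "sqrt (1 - ((a + d) / 2)\<^sup>2)"
    have "(a + d) / 2 * ((a + d) / 2) - ?r * ?r - (a + d) * ((a + d) / 2) + 1 = 0"
      using sq by (simp add: power2_eq_square field_simps)
    then show ?thesis unfolding \<mu>_def by (simp add: complex_eq_iff del: real_sqrt_mult_self)
  qed
  \<comment> \<open>\<open>\<mu>\<close> is an eigenvalue of the transfer matrix, with eigenvector \<open>(x 1, x 0) = (b, \<mu> - a)\<close>\<close>
  define y where "y = rec_nat (\<mu> - a, complex_of_real b)
      (\<lambda>n (s, t). (t, complex_of_real (E - w ! (n mod length w)) * t - s))"
  define x where "x n = fst (y n)" for n
  have snd: "snd (y n) = x (n + 1)" for n by (simp add: x_def y_def split: prod.split)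
  have x: "x 0 = \<mu> - a" "x 1 = b" by (simp_all add: x_def y_def)
  have rec: "x (n + 2) = complex_of_real (E - w ! (n mod length w)) * x (n + 1) - x n" for n
    using snd[of "n + 1"] snd[of n] by (simp add: x_def[of n] y_def split: prod.splits)
  have "x (0 + length w + 1) = a * x (0 + 1) + b * x 0 \<and> x (0 + length w) = c * x (0 + 1) + d * x 0"
    by (rule transfer_solution[OF _ M]) (use rec in auto)
  then have start: "x (0 + length w) = \<mu> * x 0" "x (1 + length w) = \<mu> * x 1"
  proof -
    assume *: "x (0 + length w + 1) = a * x (0 + 1) + b * x 0 \<and> x (0 + length w) = c * x (0 + 1) + d * x 0"
    then show "x (1 + length w) = \<mu> * x 1" using x by (simp add: algebra_simps)
    have "complex_of_real a * d - b * c = 1" using det by (metis of_real_1 of_real_diff of_real_mult)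
    then have "c * complex_of_real b + d * (\<mu> - a) = d * \<mu> - 1" by (simp add: algebra_simps)
    also have "\<dots> = \<mu> * (\<mu> - a)" using \<mu>2 by (simp add: algebra_simps)
    finally show "x (0 + length w) = \<mu> * x 0" using * x by simp
  qed
  have "x (n + length w) = \<mu> * x n \<and> x (n + 1 + length w) = \<mu> * x (n + 1)" for n
  proof (induction n)
    case 0
    then show ?case using start by simp
  next
    case (Suc n)
    have "x (n + 2 + length w) = complex_of_real (E - w ! ((n + length w) mod length w)) * x (n + 1 + length w)
        - x (n + length w)"
      using rec[of "n + length w"] by (simp add: algebra_simps)
    also have "\<dots> = \<mu> * x (n + 2)" unfolding rec[of n] using Suc by (simp add: algebra_simps)
    finally show ?case using Suc by simp
  qed
  then have "cmod (x (n + length w)) = cmod (x n)" for n by (simp add: norm_mult \<mu>1)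
  then show ?thesis using that[OF rec] x b by simp
qed

lemma l2_norm_single:
  "(\<lambda>n. if n = m then z else 0) \<in> l2" "l2_norm (\<lambda>n. if n = m then z else 0) \<le> cmod z"
proof -
  have "L2_set (\<lambda>n. cmod (if n = m then z else 0)) F \<le> cmod z" if "finite F" for F :: "int set"
  proof -
    have "L2_set (\<lambda>n. cmod (if n = m then z else 0)) F \<le> (\<Sum>n\<in>F. cmod (if n = m then z else 0))"
      by (rule L2_set_le_sum) auto
    also have "\<dots> \<le> cmod z" using that by (simp add: if_distrib[of cmod] cong: if_cong)
    finally show ?thesis .
  qed
  then show "(\<lambda>n. if n = m then z else 0) \<in> l2" "l2_norm (\<lambda>n. if n = m then z else 0) \<le> cmod z"
    by (blast intro: l2_by_finite_sums)+
qed

text \<open>A Bloch solution of the \<open>w\<close>-periodic equation, cut off outside \<open>m\<close> consecutive copies of \<open>w\<close> in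
  \<open>\<omega>\<close>, violates the equation only at the two ends, by an amount that does not depend on \<open>m\<close>, while its
  norm grows like \<open>sqrt m\<close>.\<close>

lemma band_bounded_below:
  assumes \<omega>: "\<forall>n. \<bar>\<omega> n\<bar> \<le> C" and E: "E \<in> band w" and w: "w \<noteq> []"
    and win: "window \<omega> s (m * length w) = word_power m w" and m: "0 < m"
    and bb: "bounded_below \<omega> (complex_of_real E) c"
  shows "c * sqrt (real m) \<le> 4"
proof -
  obtain x :: "nat \<Rightarrow> complex" where
    rec: "\<And>n. x (n + 2) = complex_of_real (E - w ! (n mod length w)) * x (n + 1) - x n"
    and per: "\<And>n. cmod (x (n + length w)) = cmod (x n)" and x1: "x 1 \<noteq> 0"
    using Bloch_solution[OF E w] by metis
  define l where "l = m * length w"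
  have l: "0 < l" using m w by (simp add: l_def)
  have per': "cmod (x (n + j * length w)) = cmod (x n)" for n j
  proof (induction j)
    case (Suc j)
    then show ?case using per[of "n + j * length w"] by (simp add: algebra_simps)
  qed simp
  have pot: "\<omega> (s + int n) = w ! (n mod length w)" if "n < l" for n
    using nth_window[of n l \<omega> s] nth_word_power[of n m w] win that by (simp add: l_def)
  define \<phi> where "\<phi> n = (if s \<le> n \<and> n < s + int l then x (nat (n - s) + 1) else 0)" for n
  have \<phi>: "\<phi> \<in> l2"
    by (rule l2_finite_support, rule finite_subset[of _ "{s..s + int l}"]) (auto simp: \<phi>_def)
  have \<phi>_at: "\<phi> (s + int n) = x (n + 1)" if "n < l" for n using that by (simp add: \<phi>_def)
  \<comment> \<open>each of the \<open>m\<close> copies of \<open>w\<close> contributes the same amount to the norm\<close>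
  have low: "sqrt (real m) * cmod (x (i + 1)) \<le> l2_norm \<phi>" if i: "i < length w" for i
  proof -
    let ?g = "\<lambda>j. s + int (i + j * length w)"
    have inj: "inj_on ?g {..<m}" using w by (auto simp: inj_on_def)
    have lt: "i + j * length w < l" if "j < m" for j
    proof -
      have "i + j * length w < Suc j * length w" using i by simp
      also have "\<dots> \<le> m * length w" by (rule mult_right_mono) (use that in auto)
      finally show ?thesis by (simp add: l_def)
    qed
    have "(\<Sum>n\<in>?g ` {..<m}. (cmod (\<phi> n))\<^sup>2) = (\<Sum>j<m. (cmod (x (i + 1)))\<^sup>2)"
      unfolding sum.reindex[OF inj] o_def
    proof (rule sum.cong)
      fix j assume "j \<in> {..<m}"
      then show "(cmod (\<phi> (?g j)))\<^sup>2 = (cmod (x (i + 1)))\<^sup>2"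
        using \<phi>_at[OF lt, of j] per'[of "i + 1" j] by (simp add: add.commute add.left_commute)
    qed simp
    then have "L2_set (\<lambda>n. cmod (\<phi> n)) (?g ` {..<m}) = sqrt (real m) * cmod (x (i + 1))"
      unfolding L2_set_def by (simp add: real_sqrt_mult)
    then show ?thesis using L2_set_le_l2_norm[OF \<phi>, of "?g ` {..<m}"] by simp
  qed
  have low1: "sqrt (real m) * cmod (x 1) \<le> l2_norm \<phi>" using low[of 0] w by simp
  have low0: "sqrt (real m) * cmod (x 0) \<le> l2_norm \<phi>"
    using low[of "length w - 1"] w per[of 0] by simp
  \<comment> \<open>at each end the truncation adds a term just outside the window and misses one just inside\<close>
  let ?\<delta> = "\<lambda>k z n. if n = (k::int) then z else (0::complex)"
  have res: "H_minus \<omega> (complex_of_real E) \<phi> = (\<lambda>n. (?\<delta> (s - 1) (x 1) n + ?\<delta> s (- x 0) n)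
      + (?\<delta> (s + int l) (x l) n + ?\<delta> (s + int l - 1) (- x (l + 1)) n))"
  proof
    fix n
    consider "n < s - 1" | "n = s - 1" | "s \<le> n" "n < s + int l" | "n = s + int l" | "n > s + int l"
      by linarith
    then show "H_minus \<omega> (complex_of_real E) \<phi> n = (?\<delta> (s - 1) (x 1) n + ?\<delta> s (- x 0) n)
      + (?\<delta> (s + int l) (x l) n + ?\<delta> (s + int l - 1) (- x (l + 1)) n)"
    proof cases
      case 3
      define j where "j = nat (n - s)"
      have j: "n = s + int j" "j < l" using 3 by (auto simp: j_def)
      have up: "\<phi> (n + 1) = x (j + 2) - ?\<delta> (s + int l - 1) (x (l + 1)) n"
      proof (cases "j + 1 < l")
        case True
        then show ?thesis using \<phi>_at[of "j + 1"] j by (simp add: algebra_simps)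
      next
        case False
        then have "l = j + 1" using j by simp
        then show ?thesis using j by (simp add: \<phi>_def)
      qed
      have down: "\<phi> (n - 1) = x j - ?\<delta> s (x 0) n"
      proof (cases "j = 0")
        case True
        then show ?thesis using j by (simp add: \<phi>_def)
      next
        case False
        then show ?thesis using \<phi>_at[of "j - 1"] j by (simp add: of_nat_diff algebra_simps)
      qed
      have "\<omega> n = w ! (j mod length w)" "\<phi> n = x (j + 1)" using pot[OF j(2)] \<phi>_at[OF j(2)] j(1) by auto
      then show ?thesis unfolding H_minus_alt up down using 3 rec[of j] by (simp add: algebra_simps)
    qed (use l in \<open>auto simp: H_minus_alt \<phi>_def nat_add_distrib Suc_nat_eq_nat_zadd1\<close>)
  qed
  have "l2_norm (H_minus \<omega> (complex_of_real E) \<phi>) \<le> (cmod (x 1) + cmod (x 0)) + (cmod (x l) + cmod (x (l + 1)))"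
    unfolding res
    by (intro order_trans[OF l2_add(2)] add_mono l2_add(1) l2_norm_single(1)
        order_trans[OF l2_norm_single(2)]) (simp_all)
  also have "\<dots> = 2 * (cmod (x 0) + cmod (x 1))"
    using per'[of 0 m] per'[of 1 m] by (simp add: l_def)
  finally have up: "c * l2_norm \<phi> \<le> 2 * (cmod (x 0) + cmod (x 1))"
    using bb \<phi> by (auto simp: bounded_below_def)
  have "c * sqrt (real m) * l2_norm \<phi> = sqrt (real m) * (c * l2_norm \<phi>)" by simp
  also have "\<dots> \<le> sqrt (real m) * (2 * (cmod (x 0) + cmod (x 1)))" by (intro mult_left_mono up) simp
  also have "\<dots> \<le> 4 * l2_norm \<phi>" using low0 low1 by (simp add: algebra_simps)
  finally have *: "c * sqrt (real m) * l2_norm \<phi> \<le> 4 * l2_norm \<phi>" .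
  have "0 < sqrt (real m) * cmod (x 1)" using m x1 by simp
  then have "0 < l2_norm \<phi>" using low1 by linarith
  with * show ?thesis by simp
qed

section \<open>The hierarchy with large spectrum\<close>

definition bands :: "real \<Rightarrow> real list list \<Rightarrow> real set" where
  "bands a W = {a - 2<..<a + 2} \<inter> (\<Union>w\<in>set W. band w)"

definition next_blocks :: "nat \<Rightarrow> nat \<Rightarrow> real list list \<Rightarrow> real list list" where
  "next_blocks k n W = [word_power m w @ concat W. w \<leftarrow> W, m \<leftarrow> [k + 2..<Suc n]]"

lemma set_next_blocks:
  "set (next_blocks k n W) = (\<lambda>(m, w). word_power m w @ concat W) ` ({k + 2..n} \<times> set W)"
  by (auto simp: next_blocks_def atLeastLessThanSuc_atLeastAtMost simp del: upt_Suc)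

lemma bands_measurable: "bands a W \<in> sets lborel"
  unfolding bands_def sets_lborel
  by (intro sets.Int borel_open open_UN ballI open_band open_greaterThanLessThan)

lemma next_blocks_small_loss:
  assumes "[] \<notin> set W"
  shows "\<exists>n\<ge>k + 3. emeasure lborel (bands a W - bands a (next_blocks k n W)) \<le> ennreal ((1 / 2) ^ k)"
proof -
  obtain n where n: "k + 3 \<le> n" "emeasure lborel ({a - 2<..<a + 2} \<inter> (\<Union>w\<in>set W. band w)
        - (\<Union>w\<in>set W. \<Union>m\<in>{k + 2..n}. band (word_power m w @ concat W))) < ennreal ((1 / 2) ^ k)"
    using finitely_many_exponents_suffice[where V = "set W" and \<epsilon> = "ennreal ((1 / 2) ^ k)"
        and l = "k + 3" and c = "a - 2" and d = "a + 2" and k = "k + 2" and u = "concat W"] assms by auto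
  have "bands a W - bands a (next_blocks k n W) = {a - 2<..<a + 2} \<inter> (\<Union>w\<in>set W. band w)
        - (\<Union>w\<in>set W. \<Union>m\<in>{k + 2..n}. band (word_power m w @ concat W))"
    unfolding bands_def set_next_blocks by auto
  then show ?thesis using n by (auto intro!: exI[of _ n])
qed

text \<open>The losses of all levels add up to at most \<open>2\<close>, half the length of the band of the constant
  potential \<open>a\<close>.\<close>

lemma hierarchy_with_persistent_bands:
  assumes "a \<noteq> b"
  obtains W N where "block_hierarchy a b W N" and "emeasure lborel (\<Inter>k. bands a (W k)) > 0"
proof -
  define P where "P k W \<longleftrightarrow> (k = 0 \<longrightarrow> W = [[a], [b]]) \<and> [] \<notin> set W" for k :: nat and W
  define Q where "Q k W W' \<longleftrightarrow> (\<exists>n\<ge>k + 3. W' = next_blocks k n W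
      \<and> emeasure lborel (bands a W - bands a W') \<le> ennreal ((1 / 2) ^ k))" for k W W'
  have "\<exists>W. \<forall>k. P k (W k) \<and> Q k (W k) (W (Suc k))"
  proof (rule dependent_nat_choice)
    show "\<exists>W. P 0 W" by (auto simp: P_def)
    fix W k assume "P k W"
    then have ne: "[] \<notin> set W" by (simp add: P_def)
    then obtain n where n: "n \<ge> k + 3"
      "emeasure lborel (bands a W - bands a (next_blocks k n W)) \<le> ennreal ((1 / 2) ^ k)"
      using next_blocks_small_loss by blast
    have "[] \<notin> set (next_blocks k n W)"
    proof
      assume "[] \<in> set (next_blocks k n W)"
      then obtain m w where "w \<in> set W" "[] = word_power m w @ concat W"
        unfolding set_next_blocks by auto
      then show False using ne by auto
    qed
    then show "\<exists>W'. P (Suc k) W' \<and> Q k W W'" using n by (auto simp: P_def Q_def)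
  qed
  then obtain W where W: "\<And>k. P k (W k)" "\<And>k. Q k (W k) (W (Suc k))" by blast
  then obtain N where N: "\<And>k. N k \<ge> k + 3" "\<And>k. W (Suc k) = next_blocks k (N k) (W k)"
    and loss: "\<And>k. emeasure lborel (bands a (W k) - bands a (W (Suc k))) \<le> ennreal ((1 / 2) ^ k)"
    unfolding Q_def by metis
  have W0: "W 0 = [[a], [b]]" using W(1) by (auto simp: P_def)
  have meas: "bands a (W k) \<in> sets lborel" for k by (rule bands_measurable)
  have "block_hierarchy a b W N"
    by unfold_locales (use assms W0 N in \<open>auto simp: set_next_blocks\<close>)
  moreover have "emeasure lborel (\<Inter>k. bands a (W k)) > 0"
  proof (rule ccontr)
    assume "\<not> emeasure lborel (\<Inter>k. bands a (W k)) > 0"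
    then have 0: "emeasure lborel (\<Inter>k. bands a (W k)) = 0" by simp
    define lost where "lost = (\<Union>k. bands a (W k) - bands a (W (Suc k)))"
    have start: "bands a (W 0) = {a - 2<..<a + 2}"
      by (auto simp: bands_def W0 band_def)
    have "E \<in> bands a (W k)" if "E \<in> bands a (W 0)" "E \<notin> lost" for E k
      by (induction k) (use that in \<open>auto simp: lost_def\<close>)
    then have "{a - 2<..<a + 2} \<subseteq> (\<Inter>k. bands a (W k)) \<union> lost" using start by blast
    moreover have sets: "lost \<in> sets lborel" "(\<Inter>k. bands a (W k)) \<in> sets lborel"
      unfolding lost_def using meas by auto
    ultimately have "emeasure lborel {a - 2<..<a + 2} \<le> emeasure lborel ((\<Inter>k. bands a (W k)) \<union> lost)"
      by (intro emeasure_mono) auto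
    also have "\<dots> \<le> emeasure lborel (\<Inter>k. bands a (W k)) + emeasure lborel lost"
      by (rule emeasure_subadditive) (use sets in auto)
    also have "\<dots> = emeasure lborel lost" using 0 by simp
    also have "\<dots> \<le> (\<Sum>k. emeasure lborel (bands a (W k) - bands a (W (Suc k))))"
      unfolding lost_def by (rule emeasure_subadditive_countably) (use meas in auto)
    also have "\<dots> \<le> (\<Sum>k. ennreal ((1 / 2) ^ k))" by (intro suminf_le loss) auto
    also have "\<dots> = ennreal 2"
      by (rule suminf_ennreal_eq) (use geometric_sums[of "1 / 2 :: real"] in auto)
    finally have "emeasure lborel {a - 2<..<a + 2} \<le> ennreal 2" .
    moreover have "emeasure lborel {a - 2<..<a + 2} = ennreal 4"
      by (subst emeasure_lborel_Ioo) auto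
    ultimately show False by simp
  qed
  ultimately show ?thesis using that by blast
qed

lemma (in block_hierarchy) language_shift_bounded:
  assumes "\<omega> \<in> language_shift L" shows "\<forall>n. \<bar>\<omega> n\<bar> \<le> \<bar>a\<bar> + \<bar>b\<bar>"
proof
  fix n
  have "\<omega> n \<in> {a, b}" using language_shift_subset assms by (auto simp: full_shift_def)
  then show "\<bar>\<omega> n\<bar> \<le> \<bar>a\<bar> + \<bar>b\<bar>" by auto
qed

text \<open>An energy in a band of every level has Bloch solutions on arbitrarily many repetitions of some
  block, and these repetitions occur in every sequence of the subshift.\<close>

lemma (in block_hierarchy) persistent_bands_subset_spectrum:
  assumes \<omega>: "\<omega> \<in> language_shift L" and E: "\<And>k. E \<in> bands a (W k)"
  shows "complex_of_real E \<in> spectrum (schrodinger \<omega>)"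
proof -
  note bdd = language_shift_bounded[OF \<omega>]
  have "False" if c: "c > 0" "bounded_below \<omega> (complex_of_real E) c" for c
  proof -
    obtain k :: nat where k: "(4 / c)\<^sup>2 < real k" using reals_Archimedean2 by blast
    obtain w where w: "w \<in> set (W k)" "E \<in> band w" using E[of k] by (auto simp: bands_def)
    obtain i where "window \<omega> i (length (word_power (k + 2) w)) = word_power (k + 2) w"
      using word_occurs[OF \<omega> word_power_in_L[OF w(1)]] by blast
    then have "c * sqrt (real (k + 2)) \<le> 4"
      using band_bounded_below[OF bdd w(2) block_nonempty[OF w(1)] _ _ c(2), of i "k + 2"]
      unfolding length_word_power by simp
    then have "sqrt (real (k + 2)) \<le> 4 / c" using c(1) by (simp add: field_simps)
    then have "real (k + 2) \<le> (4 / c)\<^sup>2" by (rule sqrt_le_D)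
    then show False using k by simp
  qed
  then show ?thesis using spectrum_iff_not_bounded_below[OF bdd] by blast
qed

lemma (in block_hierarchy) common_spectrum:
  obtains \<Sigma> where "associated_spectrum (language_shift L) \<Sigma>"
proof -
  note bdd = language_shift_bounded
  obtain \<omega>0 where \<omega>0: "\<omega>0 \<in> language_shift L" using language_shift_nonempty by blast
  have sub: "bounded_below \<omega>' z c" if "\<omega> \<in> language_shift L" "\<omega>' \<in> language_shift L"
    "bounded_below \<omega> z c" "c > 0" for \<omega> \<omega>' z c
    by (rule bounded_below_transfer[OF bdd[OF that(1)] bdd[OF that(2)] that(3)])
      (use that windows_occur in auto)
  have "spectrum (schrodinger \<omega>) = spectrum (schrodinger \<omega>0)" if "\<omega> \<in> language_shift L" for \<omega>
    using spectrum_iff_not_bounded_below[OF bdd[OF that]] spectrum_iff_not_bounded_below[OF bdd[OF \<omega>0]]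
      sub[OF that \<omega>0] sub[OF \<omega>0 that] by blast
  moreover obtain \<Sigma> where "compact \<Sigma>" "spectrum (schrodinger \<omega>0) = complex_of_real ` \<Sigma>"
    using compact_real_spectrum[OF bdd[OF \<omega>0]] by blast
  ultimately have "associated_spectrum (language_shift L) \<Sigma>" by (auto simp: associated_spectrum_def)
  then show ?thesis by (rule that)
qed

lemma minimal_subshift_mono:
  assumes "minimal_subshift B \<Omega>" "B \<subseteq> A" shows "minimal_subshift A \<Omega>"
proof -
  have "full_shift B \<subseteq> full_shift A" using assms(2) by (auto simp: full_shift_def)
  then show ?thesis using assms(1) by (auto simp: minimal_subshift_def subshift_def)
qed

theorem theorem1:
  fixes A :: "real set"
  assumes "finite A" and "2 \<le> card A"
  shows "\<exists>\<Omega> \<Sigma>. minimal_subshift A \<Omega> \<and> not_periodic \<Omega> \<and>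
           associated_spectrum \<Omega> \<Sigma> \<and> emeasure lebesgue \<Sigma> > 0"
proof -
  obtain a b where ab: "a \<in> A" "b \<in> A" "a \<noteq> b"
    using assms card_le_Suc0_iff_eq[of A] by fastforce
  obtain W N where H: "block_hierarchy a b W N"
    and pos: "emeasure lborel (\<Inter>k. bands a (W k)) > 0"
    using hierarchy_with_persistent_bands[OF ab(3)] by metis
  interpret block_hierarchy a b W N by (rule H)
  obtain \<Sigma> where \<Sigma>: "associated_spectrum (language_shift L) \<Sigma>" using common_spectrum .
  obtain \<omega> where \<omega>: "\<omega> \<in> language_shift L" using language_shift_nonempty by blast
  have "(\<Inter>k. bands a (W k)) \<subseteq> \<Sigma>"
  proof
    fix E assume "E \<in> (\<Inter>k. bands a (W k))"
    then have "complex_of_real E \<in> spectrum (schrodinger \<omega>)"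
      by (intro persistent_bands_subset_spectrum \<omega>) auto
    then show "E \<in> \<Sigma>" using \<Sigma> \<omega> by (auto simp: associated_spectrum_def)
  qed
  moreover have "\<Sigma> \<in> sets lborel" using \<Sigma> by (auto simp: associated_spectrum_def intro: borel_compact)
  ultimately have "emeasure lborel \<Sigma> > 0"
    by (intro less_le_trans[OF pos emeasure_mono])
  then have "emeasure lebesgue \<Sigma> > 0" using \<open>\<Sigma> \<in> sets lborel\<close> by simp
  moreover have "minimal_subshift A (language_shift L)"
    by (rule minimal_subshift_mono[OF minimal_language_shift]) (use ab in auto)
  ultimately show ?thesis using not_periodic_language_shift \<Sigma> by blast
qed

end
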